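(* Let $f\in\mathscr{C}^1_{\mathbb{W}}$ be such that $\Delta^f f=0$ in weak Lagrangian sense, and set $\psi:=\nabla^f f$. Then for all $V_1,V_2\in\mathscr{C}^\infty_c(\mathbb{R}^2)$ the following three relations hold: $$0=\int_{\mathbb{R}^2}\Big[\frac{\psi}{\sqrt{1+\psi^2}}\big(-2\psi\,\nabla^fV_1-f\,\Delta^fV_1\big)+\sqrt{1+\psi^2}\,\partial_\eta V_1\Big]d\eta\,d\tau,$$ $$0=\int_{\mathbb{R}^2}\Big[\frac{\psi}{\sqrt{1+\psi^2}}\,\Delta^fV_2+\sqrt{1+\psi^2}\,\partial_\tau V_2\Big]d\eta\,d\tau,$$ and $0\le I\!I_f(V_1,V_2)$, where $$\begin{aligned}I\!I_f(V_1,V_2):=\int_{\mathbb{R}^2}\Big[&\frac{(\Delta^fV_2-2\psi\nabla^fV_1-f\Delta^fV_1)^2}{(1+\psi^2)^{3/2}}\\&+\frac{\psi}{(1+\psi^2)^{1/2}}\Big(-4\,\Delta^fV_2\,\nabla^fV_1-2\,\nabla^fV_2\,\Delta^fV_1+6f\,\nabla^fV_1\,\Delta^fV_1+6\psi\,(\nabla^fV_1)^2\Big)\\&+2\frac{\psi}{(1+\psi^2)^{1/2}}\,(\Delta^fV_2-2\psi\nabla^fV_1-f\Delta^fV_1)(\partial_\eta V_1+\partial_\tau V_2)\\&+2(1+\psi^2)^{1/2}\,(\partial_\eta V_1\,\partial_\tau V_2-\partial_\tau V_1\,\partial_\eta V_2)\Big]d\eta\,d\tau.\end{aligned}$$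
   Context: Coordinates on $\mathbb{R}^2$ are $(\eta,\tau)$. The space $\mathscr{C}^1_{\mathbb{W}}$: the continuous $f:\mathbb{R}^2\to\mathbb{R}$ for which there is $\psi:\mathbb{R}^2\to\mathbb{R}$ (necessarily continuous, denoted $\nabla^f f$) such that, writing $f_0=f(\eta_0,\tau_0)$, the functions $(\eta,\tau)\mapsto\lambda\big(-f_0+f(\eta_0+\frac{\eta}{\lambda},\,\tau_0+f_0\frac{\eta}{\lambda}+\frac{\tau}{\lambda^2})\big)$ converge, as $\lambda\to+\infty$, uniformly on compact sets to $(\eta,\tau)\mapsto\psi(\eta_0,\tau_0)\eta$, the convergence being uniform for $(\eta_0,\tau_0)$ in compact sets. (Equivalently, $f$ is continuous and the distribution $\partial_\eta f+\frac12\partial_\tau(f^2)$ is a continuous function, which then equals $\nabla^f f$.) For $f\in\mathscr{C}^1_{\mathbb{W}}$, $\nabla^f=\partial_\eta+f\partial_\tau$ is a continuous vector field on $\mathbb{R}^2$; for $v\in\mathscr{C}^1(\mathbb{R}^2)$, $\nabla^fv=\partial_\eta v+f\,\partial_\tau v$, and for $v\in\mathscr{C}^2(\mathbb{R}^2)$, $\Delta^fv:=\partial_\eta^2v+2f\,\partial_\eta\partial_\tau v+f^2\,\partial_\tau^2v+(\nabla^ff)\,\partial_\tau v$. $f\in\mathscr{C}^1_{\mathbb{W}}$ satisfies $\Delta^ff=0$ in weak Lagrangian sense if for every $p\in\mathbb{R}^2$ there is an integral curve $\gamma$ of $\nabla^f$ (a $\mathscr{C}^1$ curve on an open interval with $\gamma'(t)=(1,f(\gamma(t)))$)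 passing through $p$ such that $\nabla^ff$ is constant along $\gamma$. *)

theory Defs
  imports "HOL-Analysis.Analysis"
begin

text \<open>Points of the plane are pairs \<open>(\<eta>, \<tau>)\<close> of type \<^typ>\<open>real \<times> real\<close>.\<close>

definition d_eta :: "(real \<times> real \<Rightarrow> real) \<Rightarrow> real \<times> real \<Rightarrow> real" where
  "d_eta v p = deriv (\<lambda>x. v (x, snd p)) (fst p)"

definition d_tau :: "(real \<times> real \<Rightarrow> real) \<Rightarrow> real \<times> real \<Rightarrow> real" where
  "d_tau v p = deriv (\<lambda>y. v (fst p, y)) (snd p)"

text \<open>Frechet differentiability is demanded at each step, so that the partial derivatives taken by
  \<^const>\<open>deriv\<close> exist; for continuous partial derivatives this is no extra restriction.\<close>

fun Ck :: "nat \<Rightarrow> (real \<times> real \<Rightarrow> real) \<Rightarrow> bool" where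
  "Ck 0 v \<longleftrightarrow> continuous_on UNIV v"
| "Ck (Suc k) v \<longleftrightarrow> v differentiable_on UNIV \<and> Ck k (d_eta v) \<and> Ck k (d_tau v)"

definition Cc_smooth :: "(real \<times> real \<Rightarrow> real) set" where
  "Cc_smooth = {v. (\<forall>k. Ck k v) \<and> compact (closure {p. v p \<noteq> 0})}"

definition blowup :: "(real \<times> real \<Rightarrow> real) \<Rightarrow> real \<times> real \<Rightarrow> real \<Rightarrow> real \<times> real \<Rightarrow> real" where
  "blowup f p\<^sub>0 s q =
     s * (- f p\<^sub>0 + f (fst p\<^sub>0 + fst q / s, snd p\<^sub>0 + f p\<^sub>0 * (fst q / s) + snd q / s\<^sup>2))"

text \<open>Uniform convergence on products \<open>K \<times> L\<close> of compact sets expresses convergence that is locally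
  uniform both in the argument \<open>q\<close> and in the base point \<open>p\<^sub>0\<close>.\<close>

definition has_intrinsic_grad ::
    "(real \<times> real \<Rightarrow> real) \<Rightarrow> (real \<times> real \<Rightarrow> real) \<Rightarrow> bool" where
  "has_intrinsic_grad f \<psi> \<longleftrightarrow>
     (\<forall>K L. compact K \<longrightarrow> compact L \<longrightarrow>
        uniform_limit (K \<times> L) (\<lambda>s (p\<^sub>0, q). blowup f p\<^sub>0 s q) (\<lambda>(p\<^sub>0, q). \<psi> p\<^sub>0 * fst q) at_top)"

definition C1W :: "(real \<times> real \<Rightarrow> real) set" where
  "C1W = {f. continuous_on UNIV f \<and> (\<exists>\<psi>. has_intrinsic_grad f \<psi>)}"

text \<open>The function \<open>\<nabla>\<^sup>f f\<close>. It cannot be obtained from \<open>nabla\<close> below, since \<open>f\<close> need not have partial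
  derivatives.\<close>

definition intrinsic_grad :: "(real \<times> real \<Rightarrow> real) \<Rightarrow> real \<times> real \<Rightarrow> real" where
  "intrinsic_grad f = (THE \<psi>. has_intrinsic_grad f \<psi>)"

lemma has_intrinsic_grad_unique:
  assumes "has_intrinsic_grad f \<psi>" "has_intrinsic_grad f \<phi>"
  shows "\<psi> = \<phi>"
proof
  fix p :: "real \<times> real"
  have lim: "((\<lambda>s. blowup f p s (1, 0)) \<longlongrightarrow> g p) at_top" if "has_intrinsic_grad f g" for g
  proof -
    have "uniform_limit ({p} \<times> {(1, 0)}) (\<lambda>s (p\<^sub>0, q). blowup f p\<^sub>0 s q)
            (\<lambda>(p\<^sub>0, q). g p\<^sub>0 * fst q) at_top"
      using that unfolding has_intrinsic_grad_def by (meson compact_sing)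
    from tendsto_uniform_limitI[OF this, of "(p, (1, 0))"] show ?thesis by simp
  qed
  show "\<psi> p = \<phi> p"
    using lim[OF assms(1)] lim[OF assms(2)] by (rule tendsto_unique[OF trivial_limit_at_top_linorder])
qed

lemma intrinsic_grad_eq: "has_intrinsic_grad f \<psi> \<Longrightarrow> intrinsic_grad f = \<psi>"
  unfolding intrinsic_grad_def by (blast intro: has_intrinsic_grad_unique)

definition nabla ::
    "(real \<times> real \<Rightarrow> real) \<Rightarrow> (real \<times> real \<Rightarrow> real) \<Rightarrow> real \<times> real \<Rightarrow> real" where
  "nabla f v p = d_eta v p + f p * d_tau v p"

definition Lap ::
    "(real \<times> real \<Rightarrow> real) \<Rightarrow> (real \<times> real \<Rightarrow> real) \<Rightarrow> real \<times> real \<Rightarrow> real" where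
  "Lap f v p = d_eta (d_eta v) p + 2 * f p * d_eta (d_tau v) p + (f p)\<^sup>2 * d_tau (d_tau v) p
     + intrinsic_grad f p * d_tau v p"

definition integral_curve ::
    "(real \<times> real \<Rightarrow> real) \<Rightarrow> real set \<Rightarrow> (real \<Rightarrow> real \<times> real) \<Rightarrow> bool" where
  "integral_curve f J \<gamma> \<longleftrightarrow> open J \<and> is_interval J \<and> \<gamma> C1_differentiable_on J \<and>
     (\<forall>t\<in>J. (\<gamma> has_vector_derivative (1, f (\<gamma> t))) (at t))"

definition weak_Lagrangian_solution :: "(real \<times> real \<Rightarrow> real) \<Rightarrow> bool" where
  "weak_Lagrangian_solution f \<longleftrightarrow>
     (\<forall>p. \<exists>J \<gamma>. integral_curve f J \<gamma> \<and> p \<in> \<gamma> ` J \<and>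
        (\<lambda>t. intrinsic_grad f (\<gamma> t)) constant_on J)"

definition II ::
    "(real \<times> real \<Rightarrow> real) \<Rightarrow> (real \<times> real \<Rightarrow> real) \<Rightarrow> (real \<times> real \<Rightarrow> real) \<Rightarrow> real" where
  "II f V1 V2 =
     (let \<psi> = intrinsic_grad f in
      LINT p|lborel.
        (Lap f V2 p - 2 * \<psi> p * nabla f V1 p - f p * Lap f V1 p)\<^sup>2 / (1 + (\<psi> p)\<^sup>2) powr (3 / 2)
        + \<psi> p / sqrt (1 + (\<psi> p)\<^sup>2) *
            (- 4 * Lap f V2 p * nabla f V1 p - 2 * nabla f V2 p * Lap f V1 p
             + 6 * f p * nabla f V1 p * Lap f V1 p + 6 * \<psi> p * (nabla f V1 p)\<^sup>2)
        + 2 * (\<psi> p / sqrt (1 + (\<psi> p)\<^sup>2)) *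
            (Lap f V2 p - 2 * \<psi> p * nabla f V1 p - f p * Lap f V1 p) * (d_eta V1 p + d_tau V2 p)
        + 2 * sqrt (1 + (\<psi> p)\<^sup>2) * (d_eta V1 p * d_tau V2 p - d_tau V1 p * d_eta V2 p))"

end

theory Submission
  imports Defs
begin

text \<open>Write \<open>\<psi>\<close> for the intrinsic gradient of \<open>f\<close>. The proof passes to Lagrangian coordinates, in which
\<open>\<nabla>\<^sup>f\<close> becomes \<open>\<partial>\<^sub>t\<close> and \<open>\<Delta>\<^sup>f\<close> becomes \<open>\<partial>\<^sub>t\<^sup>2\<close>.

Along an integral curve of \<open>\<nabla>\<^sup>f\<close> the function \<open>f\<close> has derivative \<open>\<psi>\<close>. The definition only compares
\<open>f\<close> with its value at points whose deviation from the tangent line is quadratic in the time step, so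
one first has to show that integral curves deviate only quadratically
(\<open>integral_curve_quadratic_deviation\<close>). If \<open>\<psi>\<close> is constant along some integral curve through each
point, these curves are therefore parabolas, they extend to all times, and since \<open>f\<close> and \<open>\<psi>\<close> at a
point determine the parabola through it, distinct parabolas are disjoint. Labelled by their ordinate
\<open>z\<close> at time \<open>0\<close>, they are \<open>t \<mapsto> (t, T(t, z))\<close> with \<open>T(t, z) = z + b(z) t + a(z) t\<^sup>2 / 2\<close>, on which
\<open>f = b + a t\<close> and \<open>\<psi> = a\<close>. Disjointness makes \<open>T(t, \<cdot>)\<close> increasing for every \<open>t\<close>, and this forces
\<open>a\<close> to be nondecreasing (\<open>mono_acceleration\<close>).

Suppose \<open>a\<close> and \<open>b\<close> are continuously differentiable, and let \<open>J = \<partial>\<^sub>z T\<close>, \<open>c = \<surd>(1 + a\<^sup>2)\<close> and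
\<open>s = a / c\<close>. The contact variation enters through \<open>u = V1\<close> and \<open>w = V2 - f V1\<close>, pulled back to
\<open>(t, z)\<close>. The integrand of the first variation times \<open>J\<close> is then a divergence, and that of the second
variation times \<open>J\<close> equals, up to a divergence, \<open>(J w\<^sub>t\<^sub>t\<^sup>2 + a' w\<^sub>t\<^sup>2) / c\<^sup>3\<close>, which is
nonnegative because \<open>J \<ge> 0\<close> and \<open>a' \<ge> 0\<close>. Both identities rest on \<open>J\<^sub>t\<^sub>t = a'\<close>,
\<open>c' = s a'\<close> and \<open>s' = a' / c\<^sup>3\<close> (\<open>first_variation_divergence\<close>, \<open>second_variation_divergence\<close>).

In general \<open>a\<close> and \<open>b\<close> are merely continuous. Averaging \<open>a\<close>, \<open>b\<close> and \<open>z\<close> over \<open>[z, z + e]\<close> gives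
continuously differentiable data for which \<open>J\<close> is a difference quotient of \<open>T(t, \<cdot>)\<close> and \<open>a'\<close> one of
\<open>a\<close>, so both remain nonnegative. The averaged parabolas no longer carry \<open>f\<close>, but the integrals
along them converge to the integrals for \<open>f\<close> as \<open>e \<rightarrow> 0\<close>: the densities differ by a uniformly small
amount, and the total mass of \<open>J\<close> stays bounded (\<open>lagrangian_limit\<close>).\<close>

section \<open>Expansion of \<open>f\<close> along integral curves\<close>

text \<open>The blow-ups in the direction \<open>(1, 0)\<close> are continuous in the base point and converge locally uniformly
to \<open>\<psi>\<close>.\<close>

lemma intrinsic_grad_continuous:
  assumes f: "continuous_on UNIV f" and grad: "has_intrinsic_grad f \<psi>"
  shows "continuous_on UNIV \<psi>"
proof -
  have "continuous_on (cball p 1) \<psi>" for p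
  proof -
    have "uniform_limit (cball p 1 \<times> {(1, 0)}) (\<lambda>s (p, q). blowup f p s q)
            (\<lambda>(p, q). \<psi> p * fst q) at_top"
      using grad unfolding has_intrinsic_grad_def by (meson compact_cball compact_sing)
    then have "uniform_limit (cball p 1) (\<lambda>s p. blowup f p s (1, 0)) \<psi> at_top"
      unfolding uniform_limit_iff by simp
    moreover have "\<forall>\<^sub>F s in at_top. continuous_on (cball p 1) (\<lambda>p. blowup f p s (1, 0))"
    proof (rule eventuallyI)
      fix s :: real
      have "continuous_on UNIV (\<lambda>p. blowup f p s (1, 0))"
        unfolding blowup_def divide_inverse
        by (intro continuous_intros continuous_on_compose2[OF f] f) auto
      then show "continuous_on (cball p 1) (\<lambda>p. blowup f p s (1, 0))"
        by (rule continuous_on_subset) simp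
    qed
    ultimately show ?thesis
      by (intro uniform_limit_theorem[where F = at_top]) auto
  qed
  then have "isCont \<psi> p" for p
    using continuous_on_interior[of "cball p 1" \<psi> p] by (simp add: interior_cball)
  then show ?thesis by (simp add: continuous_at_imp_continuous_on)
qed

text \<open>The blow-up limit unscaled, with \<open>l\<close> in the role of \<open>1 / s\<close>: intrinsic differentiability is a
first-order expansion of \<open>f\<close> that allows an error of order \<open>l\<^sup>2\<close> in the second coordinate.\<close>

lemma intrinsic_expansion:
  assumes grad: "has_intrinsic_grad f \<psi>" and K: "compact K" and e: "e > 0"
  obtains d where "d > 0"
    "\<And>p h y l. p \<in> K \<Longrightarrow> 0 < l \<Longrightarrow> l < d \<Longrightarrow> \<bar>h\<bar> \<le> l \<Longrightarrow> \<bar>y\<bar> \<le> C * l\<^sup>2 \<Longrightarrow>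
       \<bar>f (fst p + h, snd p + f p * h + y) - f p - \<psi> p * h\<bar> \<le> e * l"
proof -
  let ?L = "{- 1..1} \<times> {- C..C} :: (real \<times> real) set"
  have "uniform_limit (K \<times> ?L) (\<lambda>s (p, q). blowup f p s q) (\<lambda>(p, q). \<psi> p * fst q) at_top"
    using grad K compact_Times[OF compact_Icc compact_Icc] unfolding has_intrinsic_grad_def by blast
  then have "\<forall>\<^sub>F s in at_top. \<forall>x\<in>K \<times> ?L.
      dist (case x of (p, q) \<Rightarrow> blowup f p s q) (case x of (p, q) \<Rightarrow> \<psi> p * fst q) < e"
    using e by (simp add: uniform_limit_iff)
  then obtain N where N: "\<And>s p q. s \<ge> N \<Longrightarrow> p \<in> K \<Longrightarrow> q \<in> ?L \<Longrightarrow>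
      \<bar>blowup f p s q - \<psi> p * fst q\<bar> < e"
    unfolding eventually_at_top_linorder dist_real_def by fastforce
  show thesis
  proof (rule that[of "1 / (\<bar>N\<bar> + 1)"])
    show "1 / (\<bar>N\<bar> + 1) > 0" by simp
    fix p h y l assume A: "p \<in> K" "0 < l" "l < 1 / (\<bar>N\<bar> + 1)" "\<bar>h\<bar> \<le> l" "\<bar>y\<bar> \<le> C * l\<^sup>2"
    have "(\<bar>N\<bar> + 1) * l < 1" using A(3) by (simp add: field_simps)
    moreover have "N * l \<le> (\<bar>N\<bar> + 1) * l" using A(2) by (intro mult_right_mono) auto
    ultimately have "1 / l \<ge> N" using A(2) by (simp add: field_simps)
    moreover have "(h / l, y / l\<^sup>2) \<in> ?L"
      using A(2,4,5) by (auto simp: field_simps abs_le_iff)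
    ultimately have "\<bar>blowup f p (1 / l) (h / l, y / l\<^sup>2) - \<psi> p * (h / l)\<bar> < e"
      using N[of "1 / l" p "(h / l, y / l\<^sup>2)"] A(1) by simp
    moreover have "blowup f p (1 / l) (h / l, y / l\<^sup>2)
        = (f (fst p + h, snd p + f p * h + y) - f p) / l"
      using A(2) by (simp add: blowup_def power_divide)
    ultimately have "\<bar>(f (fst p + h, snd p + f p * h + y) - f p - \<psi> p * h) / l\<bar> < e"
      by (simp add: diff_divide_distrib)
    then show "\<bar>f (fst p + h, snd p + f p * h + y) - f p - \<psi> p * h\<bar> \<le> e * l"
      using A(2) by (simp add: abs_divide field_simps)
  qed
qed

text \<open>Here \<open>r h\<close> is the deviation of an integral curve from its tangent line at \<open>p\<close>. By the expansion at \<open>p\<close>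
with \<open>y = 0\<close>, and the one at the nearby point of the tangent line with \<open>h = 0\<close>, which is a Hoelder
estimate of exponent \<open>1/2\<close>, the derivative of \<open>r\<close> is bounded by \<open>k \<bar>h\<bar> + \<surd>\<bar>r h\<bar>\<close>. If \<open>m\<close> is the
maximum of \<open>\<bar>r\<bar>\<close> between \<open>-\<bar>h\<bar>\<close> and \<open>\<bar>h\<bar>\<close>, then \<open>m \<le> \<bar>h\<bar> (k \<bar>h\<bar> + \<surd>m)\<close>, and absorbing \<open>\<bar>h\<bar> \<surd>m\<close> into
\<open>(m + h\<^sup>2) / 2\<close> gives the claim.\<close>

lemma integral_curve_quadratic_deviation:
  assumes grad: "has_intrinsic_grad f \<psi>"
    and d0: "d0 > 0" and r0: "r 0 = 0"
    and r: "\<And>h. \<bar>h\<bar> < d0 \<Longrightarrow>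
      (r has_real_derivative f (fst p + h, snd p + f p * h + r h) - f p) (at h)"
  obtains d C where "d > 0" "\<And>h. \<bar>h\<bar> < d \<Longrightarrow> \<bar>r h\<bar> \<le> C * h\<^sup>2"
proof -
  obtain d1 where d1: "d1 > 0" and exp:
    "\<And>q h y l. q \<in> cball p 1 \<Longrightarrow> 0 < l \<Longrightarrow> l < d1 \<Longrightarrow> \<bar>h\<bar> \<le> l \<Longrightarrow> \<bar>y\<bar> \<le> 1 * l\<^sup>2 \<Longrightarrow>
       \<bar>f (fst q + h, snd q + f q * h + y) - f q - \<psi> q * h\<bar> \<le> 1 * l"
    using intrinsic_expansion[OF grad compact_cball, of 1 p 1 1] by auto
  have "isCont r 0" using r[of 0] d0 by (auto intro: DERIV_isCont)
  then obtain d2 where d2: "d2 > 0" "\<And>h. \<bar>h\<bar> < d2 \<Longrightarrow> \<bar>r h\<bar> < d1\<^sup>2"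
    using d1 r0 unfolding continuous_at_eps_delta dist_real_def
    by (metis diff_0_right zero_less_power)
  \<comment> \<open>The last bound keeps the tangent line within distance \<open>1\<close> of \<open>p\<close>.\<close>
  define d where "d = Min {d0, d1, d2, 1 / (1 + \<bar>f p\<bar>)}"
  have d: "d > 0" "d \<le> d0" "d \<le> d1" "d \<le> d2" "d \<le> 1 / (1 + \<bar>f p\<bar>)"
    using d0 d1 d2 by (auto simp: d_def)
  define k where "k = \<bar>\<psi> p\<bar> + 1"
  \<comment> \<open>\<open>q\<close> below is the point of the tangent line with the same first coordinate.\<close>
  have slope: "\<bar>f (fst p + h, snd p + f p * h + r h) - f p\<bar> \<le> k * \<bar>h\<bar> + sqrt \<bar>r h\<bar>"
    if h: "\<bar>h\<bar> < d" for h
  proof -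
    define q where "q = (fst p + h, snd p + f p * h)"
    have "dist p q \<le> \<bar>h\<bar> + \<bar>f p * h\<bar>"
      unfolding q_def dist_prod_def dist_real_def
      by (simp add: order_trans[OF sqrt_sum_squares_le_sum_abs])
    also have "\<dots> = (1 + \<bar>f p\<bar>) * \<bar>h\<bar>" by (simp add: abs_mult algebra_simps)
    also have "\<dots> \<le> (1 + \<bar>f p\<bar>) * (1 / (1 + \<bar>f p\<bar>))"
      using h d(5) by (intro mult_left_mono) auto
    also have "\<dots> = 1"
    proof -
      have "1 + \<bar>f p\<bar> \<noteq> 0" by linarith
      then show ?thesis by simp
    qed
    finally have q: "q \<in> cball p 1" by simp
    have "\<bar>f q - f p - \<psi> p * h\<bar> \<le> \<bar>h\<bar>"
    proof (cases "h = 0")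
      case True then show ?thesis by (simp add: q_def)
    next
      case False
      then show ?thesis using exp[of p "\<bar>h\<bar>" h 0] h d(3) by (simp add: q_def)
    qed
    then have 1: "\<bar>f q - f p\<bar> \<le> k * \<bar>h\<bar>"
      using abs_triangle_ineq[of "f q - f p - \<psi> p * h" "\<psi> p * h"]
      by (simp add: k_def abs_mult algebra_simps)
    have 2: "\<bar>f (fst p + h, snd p + f p * h + r h) - f q\<bar> \<le> sqrt \<bar>r h\<bar>"
    proof (cases "r h = 0")
      case True then show ?thesis by (simp add: q_def)
    next
      case False
      have "sqrt \<bar>r h\<bar> < d1"
        using d2(2)[of h] h d(4) d1 real_less_lsqrt by auto
      then show ?thesis using exp[OF q, of "sqrt \<bar>r h\<bar>" 0 "r h"] False by (simp add: q_def)
    qed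
    show ?thesis using 1 2 by linarith
  qed
  show thesis
  proof (rule that[OF d(1)])
    fix h assume h: "\<bar>h\<bar> < d"
    have cont: "continuous_on {- \<bar>h\<bar>..\<bar>h\<bar>} r"
      by (rule continuous_at_imp_continuous_on) (use h d(2) in \<open>auto intro!: DERIV_isCont[OF r]\<close>)
    have "\<exists>x0\<in>{- \<bar>h\<bar>..\<bar>h\<bar>}. \<forall>x\<in>{- \<bar>h\<bar>..\<bar>h\<bar>}. \<bar>r x\<bar> \<le> \<bar>r x0\<bar>"
      by (intro continuous_attains_sup continuous_on_rabs cont) auto
    moreover have "x \<in> {- \<bar>h\<bar>..\<bar>h\<bar>} \<longleftrightarrow> \<bar>x\<bar> \<le> \<bar>h\<bar>" for x by auto
    ultimately obtain x0 where x0: "\<bar>x0\<bar> \<le> \<bar>h\<bar>" and max: "\<And>x. \<bar>x\<bar> \<le> \<bar>h\<bar> \<Longrightarrow> \<bar>r x\<bar> \<le> \<bar>r x0\<bar>"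
      by blast
    define m where "m = \<bar>r x0\<bar>"
    have "norm (r x0 - r 0) \<le> (k * \<bar>h\<bar> + sqrt m) * norm (x0 - 0)"
    proof (rule field_differentiable_bound[of "{- \<bar>h\<bar>..\<bar>h\<bar>}"])
      fix x assume "x \<in> {- \<bar>h\<bar>..\<bar>h\<bar>}"
      then have x: "\<bar>x\<bar> \<le> \<bar>h\<bar>" "\<bar>x\<bar> < d" using h by auto
      show "(r has_real_derivative f (fst p + x, snd p + f p * x + r x) - f p)
              (at x within {- \<bar>h\<bar>..\<bar>h\<bar>})"
        using r[of x] x d(2) by (auto intro: has_field_derivative_at_within)
      have "k * \<bar>x\<bar> \<le> k * \<bar>h\<bar>" using x by (intro mult_left_mono) (auto simp: k_def)
      moreover have "sqrt \<bar>r x\<bar> \<le> sqrt m" using max[OF x(1)] by (simp add: m_def)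
      ultimately show "norm (f (fst p + x, snd p + f p * x + r x) - f p) \<le> k * \<bar>h\<bar> + sqrt m"
        using slope[OF x(2)] unfolding real_norm_def by linarith
    qed (use x0 in auto)
    then have "m \<le> (k * \<bar>h\<bar> + sqrt m) * \<bar>x0\<bar>" by (simp add: m_def r0)
    also have "\<dots> \<le> (k * \<bar>h\<bar> + sqrt m) * \<bar>h\<bar>"
      using x0 by (intro mult_left_mono) (auto simp: k_def m_def)
    also have "\<dots> = k * h\<^sup>2 + sqrt m * \<bar>h\<bar>" by (simp add: algebra_simps power2_eq_square)
    also have "sqrt m * \<bar>h\<bar> \<le> (m + h\<^sup>2) / 2"
    proof -
      have "0 \<le> (sqrt m - \<bar>h\<bar>)\<^sup>2" by simp
      also have "\<dots> = m + h\<^sup>2 - 2 * (sqrt m * \<bar>h\<bar>)" by (simp add: power2_diff m_def)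
      finally show ?thesis by simp
    qed
    finally have "m \<le> k * h\<^sup>2 + (m + h\<^sup>2) / 2" by simp
    then have "m \<le> 2 * (k * h\<^sup>2) + h\<^sup>2" by (simp add: field_simps)
    then have "m \<le> (2 * k + 1) * h\<^sup>2" by (simp add: algebra_simps)
    then show "\<bar>r h\<bar> \<le> (2 * k + 1) * h\<^sup>2" using max[of h] by (simp add: m_def)
  qed
qed

lemma DERIV_zero_imp_eq_on_ball:
  fixes g :: "real \<Rightarrow> real"
  assumes "\<And>h. \<bar>h\<bar> < d \<Longrightarrow> (g has_real_derivative 0) (at h)" and h: "\<bar>h\<bar> < d"
  shows "g h = g 0"
proof -
  have "\<exists>c. \<forall>x\<in>ball 0 d. g x = c"
    by (rule has_field_derivative_zero_constant)
       (use assms(1) in \<open>auto simp: dist_real_def intro: has_field_derivative_at_within\<close>)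
  then obtain c where c: "\<And>x. \<bar>x\<bar> < d \<Longrightarrow> g x = c" by (auto simp: dist_real_def)
  show ?thesis using c[of h] c[of 0] h by simp
qed

text \<open>Since the first component of the velocity is \<open>1\<close>, an integral curve is the graph of a function \<open>y\<close> of
the elapsed time.\<close>

lemma integral_curve_recentred:
  assumes \<gamma>: "integral_curve f J \<gamma>" and t0: "t0 \<in> J"
  obtains d y where "d > 0" "y 0 = snd (\<gamma> t0)"
    "\<And>h. \<bar>h\<bar> < d \<Longrightarrow> t0 + h \<in> J"
    "\<And>h. \<bar>h\<bar> < d \<Longrightarrow> \<gamma> (t0 + h) = (fst (\<gamma> t0) + h, y h)"
    "\<And>h. \<bar>h\<bar> < d \<Longrightarrow> (y has_real_derivative f (fst (\<gamma> t0) + h, y h)) (at h)"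
proof -
  have J: "open J" and D: "\<And>t. t \<in> J \<Longrightarrow> (\<gamma> has_vector_derivative (1, f (\<gamma> t))) (at t)"
    using \<gamma> by (auto simp: integral_curve_def)
  obtain d where d: "d > 0" "ball t0 d \<subseteq> J" using J t0 openE by blast
  have inJ: "t0 + h \<in> J" if "\<bar>h\<bar> < d" for h
    using that d(2) by (auto simp: dist_real_def subset_iff)
  have D': "((\<lambda>h. \<gamma> (t0 + h)) has_vector_derivative (1, f (\<gamma> (t0 + h)))) (at h)" if "\<bar>h\<bar> < d" for h
  proof -
    have "((\<lambda>h. t0 + h) has_vector_derivative 1) (at h)" by (auto intro!: derivative_eq_intros)
    from vector_diff_chain_at[OF this D[OF inJ[OF that]]] show ?thesis by (simp add: o_def)
  qed
  have Dfst: "((\<lambda>h. fst (\<gamma> (t0 + h))) has_real_derivative 1) (at h)" if "\<bar>h\<bar> < d" for h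
    using bounded_linear.has_vector_derivative[OF bounded_linear_fst D'[OF that]]
    by (simp add: has_real_derivative_iff_has_vector_derivative)
  have Dsnd: "((\<lambda>h. snd (\<gamma> (t0 + h))) has_real_derivative f (\<gamma> (t0 + h))) (at h)" if "\<bar>h\<bar> < d" for h
    using bounded_linear.has_vector_derivative[OF bounded_linear_snd D'[OF that]]
    by (simp add: has_real_derivative_iff_has_vector_derivative)
  have eq: "\<gamma> (t0 + h) = (fst (\<gamma> t0) + h, snd (\<gamma> (t0 + h)))" if "\<bar>h\<bar> < d" for h
  proof -
    have "((\<lambda>h. fst (\<gamma> (t0 + h)) - h) has_real_derivative 0) (at h)" if "\<bar>h\<bar> < d" for h
      using Dfst[OF that] by (auto intro!: derivative_eq_intros)
    from DERIV_zero_imp_eq_on_ball[OF this that] show ?thesis by (simp add: prod_eq_iff)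
  qed
  show thesis
    by (rule that[of d "\<lambda>h. snd (\<gamma> (t0 + h))"]) (use d inJ eq Dsnd in auto)
qed

text \<open>The quadratic bound on the deviation puts the points of the curve within the reach of the intrinsic
expansion at \<open>p\<close>.\<close>

lemma integral_curve_slope_derivative:
  assumes grad: "has_intrinsic_grad f \<psi>"
    and d0: "d0 > 0" and y0: "y 0 = snd p"
    and y: "\<And>h. \<bar>h\<bar> < d0 \<Longrightarrow> (y has_real_derivative f (fst p + h, y h)) (at h)"
  shows "((\<lambda>h. f (fst p + h, y h)) has_real_derivative \<psi> p) (at 0)"
proof -
  define r where "r h = y h - snd p - f p * h" for h
  have yr: "y h = snd p + f p * h + r h" for h by (simp add: r_def)
  have "(r has_real_derivative f (fst p + h, snd p + f p * h + r h) - f p) (at h)" if "\<bar>h\<bar> < d0" for h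
    unfolding yr[symmetric] unfolding r_def by (auto intro!: derivative_eq_intros y that)
  moreover have "r 0 = 0" by (simp add: r_def y0)
  ultimately obtain d1 C where d1: "d1 > 0" "\<And>h. \<bar>h\<bar> < d1 \<Longrightarrow> \<bar>r h\<bar> \<le> C * h\<^sup>2"
    using integral_curve_quadratic_deviation[OF grad d0] by metis
  have "\<exists>d>0. \<forall>h. h \<noteq> 0 \<and> \<bar>h\<bar> < d \<longrightarrow>
      \<bar>(f (fst p + h, y h) - f p) / h - \<psi> p\<bar> < e" if e: "e > 0" for e
  proof -
    obtain d2 where d2: "d2 > 0" and exp:
      "\<And>q h y l. q \<in> {p} \<Longrightarrow> 0 < l \<Longrightarrow> l < d2 \<Longrightarrow> \<bar>h\<bar> \<le> l \<Longrightarrow> \<bar>y\<bar> \<le> C * l\<^sup>2 \<Longrightarrow>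
         \<bar>f (fst q + h, snd q + f q * h + y) - f q - \<psi> q * h\<bar> \<le> e / 2 * l"
      using intrinsic_expansion[OF grad compact_sing, of "e / 2" p C] e by auto
    show ?thesis
    proof (intro exI[of _ "min d1 d2"] conjI allI impI)
      fix h :: real assume h: "h \<noteq> 0 \<and> \<bar>h\<bar> < min d1 d2"
      then have "\<bar>f (fst p + h, y h) - f p - \<psi> p * h\<bar> \<le> e / 2 * \<bar>h\<bar>"
        using exp[of p "\<bar>h\<bar>" h "r h"] d1(2)[of h] by (simp add: yr)
      moreover have "(f (fst p + h, y h) - f p) / h - \<psi> p = (f (fst p + h, y h) - f p - \<psi> p * h) / h"
        using h by (simp add: field_simps)
      ultimately have "\<bar>(f (fst p + h, y h) - f p) / h - \<psi> p\<bar> \<le> e / 2"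
        using h by (simp add: abs_divide divide_le_eq)
      then show "\<bar>(f (fst p + h, y h) - f p) / h - \<psi> p\<bar> < e" using e by simp
    qed (use d1 d2 in auto)
  qed
  then show ?thesis
    unfolding DERIV_def LIM_eq by (simp add: y0)
qed

section \<open>Characteristics are parabolas\<close>

text \<open>The curve that starts at \<open>p\<close> with slope \<open>f p\<close> and constant acceleration \<open>\<psi> p\<close>.\<close>

definition parabola :: "(real \<times> real \<Rightarrow> real) \<Rightarrow> (real \<times> real \<Rightarrow> real) \<Rightarrow> real \<times> real \<Rightarrow> real \<Rightarrow> real \<times> real" where
  "parabola f \<psi> p h = (fst p + h, snd p + f p * h + \<psi> p * h\<^sup>2 / 2)"

lemma characteristic_locally_parabola:
  assumes grad: "has_intrinsic_grad f \<psi>"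
    and \<gamma>: "integral_curve f J \<gamma>" and p: "p \<in> \<gamma> ` J" and const: "(\<lambda>t. \<psi> (\<gamma> t)) constant_on J"
  obtains d where "d > 0"
    "\<And>h. \<bar>h\<bar> < d \<Longrightarrow> f (parabola f \<psi> p h) = f p + \<psi> p * h \<and> \<psi> (parabola f \<psi> p h) = \<psi> p"
proof -
  obtain t0 where t0: "t0 \<in> J" "p = \<gamma> t0" using p by auto
  obtain d y where d: "d > 0" and y0: "y 0 = snd p" and inJ: "\<And>h. \<bar>h\<bar> < d \<Longrightarrow> t0 + h \<in> J"
    and \<gamma>y: "\<And>h. \<bar>h\<bar> < d \<Longrightarrow> \<gamma> (t0 + h) = (fst p + h, y h)"
    and y: "\<And>h. \<bar>h\<bar> < d \<Longrightarrow> (y has_real_derivative f (fst p + h, y h)) (at h)"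
    using integral_curve_recentred[OF \<gamma> t0(1)] unfolding t0(2) by metis
  have \<psi>c: "\<psi> (fst p + h, y h) = \<psi> p" if "\<bar>h\<bar> < d" for h
    using const inJ[OF that] t0 \<gamma>y[OF that] unfolding constant_on_def by metis
  have Df: "((\<lambda>h. f (fst p + h, y h)) has_real_derivative \<psi> p) (at h)" if h: "\<bar>h\<bar> < d" for h
  proof -
    have "((\<lambda>x. f (fst (fst p + h, y h) + x, y (h + x))) has_real_derivative \<psi> (fst p + h, y h)) (at 0)"
    proof (rule integral_curve_slope_derivative[OF grad, of "d - \<bar>h\<bar>"])
      fix x :: real assume "\<bar>x\<bar> < d - \<bar>h\<bar>"
      then have "\<bar>h + x\<bar> < d" by linarith
      from DERIV_shift[THEN iffD1, of y _ x h] y[OF this]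
      show "((\<lambda>x. y (h + x)) has_real_derivative f (fst (fst p + h, y h) + x, y (h + x))) (at x)"
        by (simp add: add.commute add.left_commute add.assoc)
    qed (use h in auto)
    then have "((\<lambda>x. f (fst p + (x + h), y (x + h))) has_real_derivative \<psi> p) (at 0)"
      using \<psi>c[OF h] by (simp add: add.commute add.left_commute add.assoc)
    then show ?thesis using DERIV_shift[of "\<lambda>x. f (fst p + x, y x)" "\<psi> p" 0 h] by simp
  qed
  have fy: "f (fst p + h, y h) = f p + \<psi> p * h" if "\<bar>h\<bar> < d" for h
  proof -
    have "((\<lambda>h. f (fst p + h, y h) - \<psi> p * h) has_real_derivative 0) (at h)" if "\<bar>h\<bar> < d" for h
      by (auto intro!: derivative_eq_intros Df that)
    from DERIV_zero_imp_eq_on_ball[OF this that] show ?thesis by (simp add: y0)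
  qed
  have yp: "y h = snd p + f p * h + \<psi> p * h\<^sup>2 / 2" if "\<bar>h\<bar> < d" for h
  proof -
    have "((\<lambda>h. y h - (f p * h + \<psi> p * h\<^sup>2 / 2)) has_real_derivative 0) (at h)" if "\<bar>h\<bar> < d" for h
      using y[OF that] unfolding fy[OF that] by (auto intro!: derivative_eq_intros)
    from DERIV_zero_imp_eq_on_ball[OF this that] show ?thesis by (simp add: y0)
  qed
  show thesis
    by (rule that[OF d]) (use fy \<psi>c in \<open>simp add: parabola_def flip: yp\<close>)
qed

lemma parabola_add:
  assumes "f (parabola f \<psi> p h) = f p + \<psi> p * h" "\<psi> (parabola f \<psi> p h) = \<psi> p"
  shows "parabola f \<psi> (parabola f \<psi> p h) k = parabola f \<psi> p (h + k)"
  unfolding parabola_def[of _ _ "parabola f \<psi> p h"] assms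
  by (simp add: parabola_def power2_eq_square field_simps)

text \<open>The set of times at which the parabola through \<open>p\<close> carries the expected values is closed by
continuity. It is open because a parabola with these values at one of its points is, by
\<open>parabola_add\<close>, also the parabola through that point, so that the local statement applies there.\<close>

lemma characteristics_are_parabolas:
  assumes f: "continuous_on UNIV f" and grad: "has_intrinsic_grad f \<psi>"
    and wl: "weak_Lagrangian_solution f"
  shows "f (parabola f \<psi> p h) = f p + \<psi> p * h \<and> \<psi> (parabola f \<psi> p h) = \<psi> p"
proof -
  have \<psi>: "continuous_on UNIV \<psi>" by (rule intrinsic_grad_continuous[OF f grad])
  have cP: "continuous_on UNIV (parabola f \<psi> p)"
    unfolding parabola_def by (intro continuous_intros) auto
  define S where "S = {h. f (parabola f \<psi> p h) = f p + \<psi> p * h \<and> \<psi> (parabola f \<psi> p h) = \<psi> p}"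
  have "closed S"
    unfolding S_def
    by (intro closed_Collect_conj closed_Collect_eq continuous_intros
        continuous_on_compose2[OF f cP] continuous_on_compose2[OF \<psi> cP]) auto
  moreover have "open S"
    unfolding open_dist
  proof
    fix h assume "h \<in> S"
    then have h: "f (parabola f \<psi> p h) = f p + \<psi> p * h" "\<psi> (parabola f \<psi> p h) = \<psi> p"
      by (auto simp: S_def)
    obtain J \<gamma> where "integral_curve f J \<gamma>" "parabola f \<psi> p h \<in> \<gamma> ` J" "(\<lambda>t. \<psi> (\<gamma> t)) constant_on J"
      using wl intrinsic_grad_eq[OF grad] unfolding weak_Lagrangian_solution_def by metis
    from characteristic_locally_parabola[OF grad this]
    obtain d where d: "d > 0" and loc: "\<And>k. \<bar>k\<bar> < d \<Longrightarrow>
        f (parabola f \<psi> (parabola f \<psi> p h) k) = f (parabola f \<psi> p h) + \<psi> (parabola f \<psi> p h) * k \<and>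
        \<psi> (parabola f \<psi> (parabola f \<psi> p h) k) = \<psi> (parabola f \<psi> p h)"
      by metis
    have "x \<in> S" if "dist x h < d" for x
      using loc[of "x - h"] that h unfolding parabola_add[OF h]
      by (simp add: S_def dist_real_def algebra_simps)
    then show "\<exists>e>0. \<forall>y. dist y h < e \<longrightarrow> y \<in> S" using d by blast
  qed
  moreover have "0 \<in> S" by (simp add: S_def parabola_def)
  ultimately have "S = UNIV" using clopen[of S] by auto
  then show ?thesis by (auto simp: S_def)
qed

section \<open>The foliation by parabolas\<close>

text \<open>The ordinate at time \<open>t\<close> of the parabola with label \<open>z\<close>, the ordinate at time \<open>0\<close>.\<close>

definition height :: "(real \<times> real \<Rightarrow> real) \<Rightarrow> (real \<times> real \<Rightarrow> real) \<Rightarrow> real \<Rightarrow> real \<Rightarrow> real" where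
  "height f \<psi> t z = z + f (0, z) * t + \<psi> (0, z) * t\<^sup>2 / 2"

text \<open>This is all that the sequel needs to know about a weak Lagrangian solution.\<close>

locale parabolic_foliation =
  fixes f \<psi> :: "real \<times> real \<Rightarrow> real"
  assumes cont_f: "continuous_on UNIV f" and cont_\<psi>: "continuous_on UNIV \<psi>"
    and on_parabola: "\<And>p h. f (parabola f \<psi> p h) = f p + \<psi> p * h"
      "\<And>p h. \<psi> (parabola f \<psi> p h) = \<psi> p"
begin

lemma along_height:
  "f (t, height f \<psi> t z) = f (0, z) + \<psi> (0, z) * t" "\<psi> (t, height f \<psi> t z) = \<psi> (0, z)"
  using on_parabola[of "(0, z)" t] by (simp_all add: parabola_def height_def)

text \<open>The label of the parabola through \<open>(t, y)\<close>, an explicit and continuous inverse of \<open>height\<close>.\<close>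

definition foot :: "real \<Rightarrow> real \<Rightarrow> real" where
  "foot t y = y - f (t, y) * t + \<psi> (t, y) * t\<^sup>2 / 2"

lemma foot_height: "foot t (height f \<psi> t z) = z"
  unfolding foot_def along_height by (simp add: height_def power2_eq_square field_simps)

lemma height_foot: "height f \<psi> t (foot t y) = y"
proof -
  have "parabola f \<psi> (t, y) (- t) = (0, foot t y)" by (simp add: parabola_def foot_def)
  then have "f (0, foot t y) = f (t, y) - \<psi> (t, y) * t" "\<psi> (0, foot t y) = \<psi> (t, y)"
    using on_parabola[of "(t, y)" "- t"] by simp_all
  then have "height f \<psi> t (foot t y) = foot t y + (f (t, y) - \<psi> (t, y) * t) * t + \<psi> (t, y) * t\<^sup>2 / 2"
    by (simp only: height_def)
  then show ?thesis by (simp add: foot_def power2_eq_square field_simps)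
qed

lemma continuous_height: "continuous_on UNIV (\<lambda>t. height f \<psi> t z)"
  unfolding height_def by (intro continuous_intros) auto

text \<open>The difference of two heights is continuous in \<open>t\<close>, never zero since the label can be recovered from
the height, and positive at time \<open>0\<close>.\<close>

lemma height_strict_mono:
  assumes "z < z'" shows "height f \<psi> t z < height f \<psi> t z'"
proof (rule ccontr)
  let ?D = "\<lambda>t. height f \<psi> t z' - height f \<psi> t z"
  assume "\<not> ?thesis"
  then have "?D t \<le> 0" by simp
  moreover have "?D 0 > 0" using assms by (simp add: height_def)
  moreover have "connected (range ?D)"
    by (intro connected_continuous_image continuous_intros continuous_height connected_UNIV)
  ultimately have "0 \<in> range ?D"
    using connectedD_interval[of "range ?D" "?D t" "?D 0" 0] by auto
  then obtain s where "height f \<psi> s z' = height f \<psi> s z" by auto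
  then show False using foot_height[of s] assms by (metis less_irrefl)
qed

lemma height_mono: "z \<le> z' \<Longrightarrow> height f \<psi> t z \<le> height f \<psi> t z'"
  using height_strict_mono[of z z' t] by (cases "z = z'") auto

text \<open>The order of two parabolas is the same at times \<open>t\<close> and \<open>-t\<close>. In the sum of the two inequalities the
linear terms cancel, and a negative difference of the accelerations would win for large \<open>t\<close>.\<close>

lemma mono_acceleration: "mono (\<lambda>z. \<psi> (0, z))"
proof (rule monoI, rule ccontr)
  fix z z' :: real assume z: "z \<le> z'" and "\<not> \<psi> (0, z) \<le> \<psi> (0, z')"
  define k where "k = \<psi> (0, z) - \<psi> (0, z')"
  have k: "k > 0" using \<open>\<not> _\<close> by (simp add: k_def)
  \<comment> \<open>Any \<open>t\<close> with \<open>k * t\<^sup>2 > 2 * (z' - z)\<close> would do.\<close>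
  define t where "t = sqrt (2 * (z' - z) / k + 1)"
  have t2: "t\<^sup>2 = 2 * (z' - z) / k + 1" using z k by (simp add: t_def)
  have "height f \<psi> t z + height f \<psi> (- t) z \<le> height f \<psi> t z' + height f \<psi> (- t) z'"
    using height_mono[OF z, of t] height_mono[OF z, of "- t"] by simp
  then have "k * t\<^sup>2 \<le> 2 * (z' - z)" by (simp add: height_def k_def algebra_simps)
  moreover have "k * t\<^sup>2 = 2 * (z' - z) + k" using k by (simp add: t2 distrib_left)
  ultimately show False using k by simp
qed

text \<open>The parabolas with labels \<open>M\<close> and \<open>1 - M\<close> enclose the square of side \<open>2 R\<close>. The label \<open>1 - M\<close> in place
of \<open>- M\<close> leaves room for averaging over labels in \<open>[- M, 1 - M]\<close>.\<close>

lemma height_beyond: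
  obtains M where "M > 1" "\<And>t. \<bar>t\<bar> \<le> R \<Longrightarrow> height f \<psi> t M \<ge> R"
    "\<And>t. \<bar>t\<bar> \<le> R \<Longrightarrow> height f \<psi> t (1 - M) \<le> - R"
proof -
  let ?K = "{- R..R} \<times> {- R, R}"
  have "continuous_on UNIV (\<lambda>(t, y). foot t y)"
    unfolding foot_def split_def
    by (intro continuous_intros continuous_on_compose2[OF cont_f] continuous_on_compose2[OF cont_\<psi>]) auto
  then have "compact ((\<lambda>(t, y). foot t y) ` ?K)"
    by (intro compact_continuous_image compact_Times) (auto intro: continuous_on_subset)
  then obtain B where B: "\<And>x. x \<in> (\<lambda>(t, y). foot t y) ` ?K \<Longrightarrow> \<bar>x\<bar> \<le> B"
    using compact_imp_bounded bounded_real by metis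
  have B': "\<bar>foot t R\<bar> \<le> B" "\<bar>foot t (- R)\<bar> \<le> B" if "\<bar>t\<bar> \<le> R" for t
    using B[of "foot t R"] B[of "foot t (- R)"] that by (force simp: abs_le_iff)+
  show thesis
  proof (rule that[of "\<bar>B\<bar> + 2"])
    fix t :: real assume t: "\<bar>t\<bar> \<le> R"
    show "height f \<psi> t (\<bar>B\<bar> + 2) \<ge> R"
      using height_mono[of "foot t R" "\<bar>B\<bar> + 2" t] B'[OF t] height_foot[of t R] by linarith
    show "height f \<psi> t (1 - (\<bar>B\<bar> + 2)) \<le> - R"
      using height_mono[of "1 - (\<bar>B\<bar> + 2)" "foot t (- R)" t] B'[OF t] height_foot[of t "- R"] by linarith
  qed simp
qed

end

lemma weak_Lagrangian_parabolic_foliation: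
  assumes "f \<in> C1W" "weak_Lagrangian_solution f"
  shows "parabolic_foliation f (intrinsic_grad f)"
proof -
  obtain \<psi> where f: "continuous_on UNIV f" and \<psi>: "has_intrinsic_grad f \<psi>"
    using assms(1) by (auto simp: C1W_def)
  show ?thesis
    unfolding intrinsic_grad_eq[OF \<psi>]
    using characteristics_are_parabolas[OF f \<psi> assms(2)] f intrinsic_grad_continuous[OF f \<psi>]
    by unfold_locales auto
qed

section \<open>Calculus in the plane\<close>

lemma has_derivative_partials:
  assumes "V differentiable_on UNIV"
  shows "(V has_derivative (\<lambda>h. d_eta V p * fst h + d_tau V p * snd h)) (at p)"
proof -
  obtain D where D: "(V has_derivative D) (at p)"
    using assms unfolding differentiable_on_def differentiable_def by (meson UNIV_I)
  define A B where "A = D (1, 0)" and "B = D (0, 1)"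
  have lin: "D h = A * fst h + B * snd h" for h
    using linear_add[OF has_derivative_linear[OF D], of "fst h *\<^sub>R (1, 0)" "snd h *\<^sub>R (0, 1)"]
      linear_scale[OF has_derivative_linear[OF D], of "fst h" "(1, 0)"]
      linear_scale[OF has_derivative_linear[OF D], of "snd h" "(0, 1)"]
    by (simp add: A_def B_def mult.commute)
  have 1: "d_eta V p = A"
  proof -
    have "((\<lambda>x. (x, snd p)) has_derivative (\<lambda>h. (h, 0))) (at (fst p))"
      by (intro has_derivative_Pair has_derivative_ident has_derivative_const)
    from has_derivative_compose[OF this] D
    have "((\<lambda>x. V (x, snd p)) has_derivative (\<lambda>h. D (h, 0))) (at (fst p))" by simp
    then have "((\<lambda>x. V (x, snd p)) has_real_derivative A) (at (fst p))"
      unfolding has_field_derivative_def by (rule has_derivative_eq_rhs) (simp add: lin fun_eq_iff)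
    then show ?thesis unfolding d_eta_def by (rule DERIV_imp_deriv)
  qed
  have 2: "d_tau V p = B"
  proof -
    have "((\<lambda>y. (fst p, y)) has_derivative (\<lambda>h. (0, h))) (at (snd p))"
      by (intro has_derivative_Pair has_derivative_ident has_derivative_const)
    from has_derivative_compose[OF this] D
    have "((\<lambda>y. V (fst p, y)) has_derivative (\<lambda>h. D (0, h))) (at (snd p))" by simp
    then have "((\<lambda>y. V (fst p, y)) has_real_derivative B) (at (snd p))"
      unfolding has_field_derivative_def by (rule has_derivative_eq_rhs) (simp add: lin fun_eq_iff)
    then show ?thesis unfolding d_tau_def by (rule DERIV_imp_deriv)
  qed
  show ?thesis
    using D unfolding 1 2 by (rule has_derivative_eq_rhs) (simp add: lin fun_eq_iff)
qed

lemma DERIV_along_curve: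
  assumes V: "V differentiable_on UNIV"
    and x: "(x has_real_derivative x') (at t)" and y: "(y has_real_derivative y') (at t)"
  shows "((\<lambda>t. V (x t, y t)) has_real_derivative
            d_eta V (x t, y t) * x' + d_tau V (x t, y t) * y') (at t)"
proof -
  have "((\<lambda>t. (x t, y t)) has_derivative (\<lambda>h. (x' * h, y' * h))) (at t)"
    using x y unfolding has_field_derivative_def by (rule has_derivative_Pair)
  from has_derivative_compose[OF this has_derivative_partials[OF V]]
  show ?thesis
    unfolding has_field_derivative_def
    by (rule has_derivative_eq_rhs) (simp add: fun_eq_iff algebra_simps)
qed

lemma DERIV_slices:
  assumes "U differentiable_on UNIV"
  shows "((\<lambda>x. U (x, y)) has_real_derivative d_eta U (x, y)) (at x)"
    and "((\<lambda>y. U (x, y)) has_real_derivative d_tau U (x, y)) (at y)"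
proof -
  show "((\<lambda>x. U (x, y)) has_real_derivative d_eta U (x, y)) (at x)"
    by (rule DERIV_cong[OF DERIV_along_curve[OF assms DERIV_ident DERIV_const]]) simp
  show "((\<lambda>y. U (x, y)) has_real_derivative d_tau U (x, y)) (at y)"
    by (rule DERIV_cong[OF DERIV_along_curve[OF assms DERIV_const DERIV_ident]]) simp
qed

text \<open>Differentiating \<open>V(x, y) - V(x, y0 - 1) = \<integral> \<partial>\<^sub>\<tau> V(x, r) dr\<close> under the integral sign in \<open>x\<close>, and then in
\<open>y\<close>.\<close>

lemma mixed_partials_commute:
  assumes "Ck 2 V"
  shows "d_tau (d_eta V) p = d_eta (d_tau V) p"
proof -
  have V: "V differentiable_on UNIV" "d_eta V differentiable_on UNIV" "d_tau V differentiable_on UNIV"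
    and mixed: "continuous_on UNIV (d_eta (d_tau V))"
    using assms by (auto simp: numeral_2_eq_2)
  define x0 y0 where "x0 = fst p" and "y0 = snd p"
  have c\<tau>: "continuous_on UNIV (d_tau V)" by (rule differentiable_imp_continuous_on[OF V(3)])
  have FTC: "integral {y0 - 1..y} (\<lambda>r. d_tau V (x, r)) = V (x, y) - V (x, y0 - 1)"
    if "y \<ge> y0 - 1" for x y
  proof (rule integral_unique, rule fundamental_theorem_of_calculus[OF that])
    show "((\<lambda>r. V (x, r)) has_vector_derivative d_tau V (x, r)) (at r within {y0 - 1..y})" for r
      using DERIV_slices(2)[OF V(1), of x r]
      unfolding has_real_derivative_iff_has_vector_derivative
      by (rule has_vector_derivative_at_within)
  qed
  have diff: "d_eta V (x0, y) - d_eta V (x0, y0 - 1) = integral {y0 - 1..y} (\<lambda>s. d_eta (d_tau V) (x0, s))"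
    if y: "y \<ge> y0 - 1" for y
  proof -
    have "((\<lambda>x. integral (cbox (y0 - 1) y) (\<lambda>s. d_tau V (x, s))) has_real_derivative
            integral (cbox (y0 - 1) y) (\<lambda>s. d_eta (d_tau V) (x0, s))) (at x0 within UNIV)"
    proof (rule leibniz_rule_field_derivative)
      show "(\<lambda>s. d_tau V (x, s)) integrable_on cbox (y0 - 1) y" for x
        by (intro integrable_continuous continuous_on_compose2[OF c\<tau>] continuous_intros) simp
      show "continuous_on (UNIV \<times> cbox (y0 - 1) y) (\<lambda>(x, s). d_eta (d_tau V) (x, s))"
        using continuous_on_subset[OF mixed] by (simp add: split_def)
    qed (simp_all add: DERIV_slices(1)[OF V(3)])
    then have "((\<lambda>x. V (x, y) - V (x, y0 - 1)) has_real_derivative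
            integral {y0 - 1..y} (\<lambda>s. d_eta (d_tau V) (x0, s))) (at x0)"
      unfolding box_real FTC[OF y] .
    moreover have "((\<lambda>x. V (x, y) - V (x, y0 - 1)) has_real_derivative
            d_eta V (x0, y) - d_eta V (x0, y0 - 1)) (at x0)"
      by (intro DERIV_diff DERIV_slices V)
    ultimately show ?thesis by (rule DERIV_unique[symmetric])
  qed
  have eq: "d_eta V (x0, y) = d_eta V (x0, y0 - 1) + integral {y0 - 1..y} (\<lambda>s. d_eta (d_tau V) (x0, s))"
    if "y \<ge> y0 - 1" for y
    using diff[OF that] by linarith
  have "((\<lambda>y. integral {y0 - 1..y} (\<lambda>s. d_eta (d_tau V) (x0, s))) has_real_derivative
          d_eta (d_tau V) (x0, y0)) (at y0 within {y0 - 1..y0 + 1})"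
  proof (rule integral_has_real_derivative)
    show "continuous_on {y0 - 1..y0 + 1} (\<lambda>s. d_eta (d_tau V) (x0, s))"
      by (rule continuous_on_compose2[OF mixed]) (intro continuous_intros, simp)
  qed simp
  then have "((\<lambda>y. integral {y0 - 1..y} (\<lambda>s. d_eta (d_tau V) (x0, s))) has_real_derivative
          d_eta (d_tau V) (x0, y0)) (at y0)"
    using at_within_interior[of y0 "{y0 - 1..y0 + 1}"] by simp
  then have "((\<lambda>y. d_eta V (x0, y0 - 1) + integral {y0 - 1..y} (\<lambda>s. d_eta (d_tau V) (x0, s)))
          has_real_derivative d_eta (d_tau V) (x0, y0)) (at y0)"
    by (rule DERIV_cong[OF DERIV_add[OF DERIV_const]]) simp
  then have "((\<lambda>y. d_eta V (x0, y)) has_real_derivative d_eta (d_tau V) (x0, y0)) (at y0)"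
    by (rule has_field_derivative_transform_within[of _ _ _ _ 1])
       (auto simp: dist_real_def intro!: eq[symmetric])
  then show ?thesis by (simp add: d_tau_def DERIV_imp_deriv x0_def y0_def)
qed

lemma integral_box_divergence:
  fixes X Y x y :: "real \<Rightarrow> real \<Rightarrow> real"
  assumes X: "\<And>t z. ((\<lambda>t. X t z) has_real_derivative x t z) (at t)"
    and Y: "\<And>t z. (Y t has_real_derivative y t z) (at z)"
    and cx: "continuous_on UNIV (\<lambda>p. x (fst p) (snd p))"
    and cy: "continuous_on UNIV (\<lambda>p. y (fst p) (snd p))"
    and R: "R \<ge> 0" and M: "M \<ge> 0"
    and X0: "\<And>z. X (- R) z = 0" "\<And>z. X R z = 0"
    and Y0: "\<And>t. \<bar>t\<bar> \<le> R \<Longrightarrow> Y t (- M) = 0" "\<And>t. \<bar>t\<bar> \<le> R \<Longrightarrow> Y t M = 0"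
  shows "integral (cbox (- R, - M) (R, M)) (\<lambda>(t, z). x t z + y t z) = 0"
proof -
  have cont: "continuous_on (cbox (- R, - M) (R, M)) (\<lambda>p. x (fst p) (snd p))"
     "continuous_on (cbox (- R, - M) (R, M)) (\<lambda>p. y (fst p) (snd p))"
    using cx cy continuous_on_subset by blast+
  have ftc: "integral {- l..l} h = 0"
    if "\<And>t. (H has_real_derivative h t) (at t)" "l \<ge> 0" "H (- l) = 0" "H l = 0" for H h and l :: real
  proof (rule integral_unique)
    have "(h has_integral (H l - H (- l))) {- l..l}"
    proof (rule fundamental_theorem_of_calculus)
      show "(H has_vector_derivative h t) (at t within {- l..l})" for t
        using that(1)[of t] unfolding has_real_derivative_iff_has_vector_derivative
        by (rule has_vector_derivative_at_within)
    qed (use that in simp)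
    then show "(h has_integral 0) {- l..l}" using that by simp
  qed
  have "integral (cbox (- R, - M) (R, M)) (\<lambda>p. x (fst p) (snd p))
      = integral {- R..R} (\<lambda>t. integral {- M..M} (\<lambda>z. x t z))"
    using integral_prod_continuous[OF cont(1)] by simp
  also have "\<dots> = integral {- M..M} (\<lambda>z. integral {- R..R} (\<lambda>t. x t z))"
    using integral_swap_continuous[of "- R" "- M" R M x] cont(1) by (simp add: split_def)
  also have "\<dots> = 0" by (simp add: ftc[OF X R X0])
  finally have 1: "integral (cbox (- R, - M) (R, M)) (\<lambda>p. x (fst p) (snd p)) = 0" .
  have "integral (cbox (- R, - M) (R, M)) (\<lambda>p. y (fst p) (snd p))
      = integral {- R..R} (\<lambda>t. integral {- M..M} (\<lambda>z. y t z))"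
    using integral_prod_continuous[OF cont(2)] by simp
  also have "\<dots> = integral {- R..R} (\<lambda>t. 0)"
    by (intro integral_cong ftc[OF Y M] Y0) auto
  finally have 2: "integral (cbox (- R, - M) (R, M)) (\<lambda>p. y (fst p) (snd p)) = 0" by simp
  show ?thesis
    using 1 2 integral_add[OF integrable_continuous[OF cont(1)] integrable_continuous[OF cont(2)]]
    by (simp add: split_def)
qed

section \<open>Lagrangian coordinates of a smooth family of parabolas\<close>

text \<open>The functions \<open>v\<close>, \<open>v\<^sub>t\<close>, \<open>v\<^sub>t\<^sub>t\<close>, \<open>v\<^sub>z\<close>, \<open>v\<^sub>t\<^sub>z\<close> of time and label. There is no \<open>v\<^sub>z\<^sub>z\<close>, since the
families considered are only once differentiable in the label.\<close>

definition jet :: "(real \<Rightarrow> real \<Rightarrow> real) \<Rightarrow> (real \<Rightarrow> real \<Rightarrow> real) \<Rightarrow> (real \<Rightarrow> real \<Rightarrow> real) \<Rightarrow>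
    (real \<Rightarrow> real \<Rightarrow> real) \<Rightarrow> (real \<Rightarrow> real \<Rightarrow> real) \<Rightarrow> bool" where
  "jet v vt vtt vz vtz \<longleftrightarrow>
     (\<forall>t z. ((\<lambda>t. v t z) has_real_derivative vt t z) (at t) \<and>
            ((\<lambda>t. vt t z) has_real_derivative vtt t z) (at t) \<and>
            ((\<lambda>z. v t z) has_real_derivative vz t z) (at z) \<and>
            ((\<lambda>z. vt t z) has_real_derivative vtz t z) (at z) \<and>
            ((\<lambda>t. vz t z) has_real_derivative vtz t z) (at t)) \<and>
     continuous_on UNIV (\<lambda>p. v (fst p) (snd p)) \<and> continuous_on UNIV (\<lambda>p. vt (fst p) (snd p)) \<and>
     continuous_on UNIV (\<lambda>p. vtt (fst p) (snd p)) \<and> continuous_on UNIV (\<lambda>p. vz (fst p) (snd p)) \<and>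
     continuous_on UNIV (\<lambda>p. vtz (fst p) (snd p))"

lemma jetD:
  assumes "jet v vt vtt vz vtz"
  shows "((\<lambda>t. v t z) has_real_derivative vt t z) (at t)"
    "((\<lambda>t. vt t z) has_real_derivative vtt t z) (at t)"
    "((\<lambda>z. v t z) has_real_derivative vz t z) (at z)"
    "((\<lambda>z. vt t z) has_real_derivative vtz t z) (at z)"
    "((\<lambda>t. vz t z) has_real_derivative vtz t z) (at t)"
  using assms by (simp_all add: jet_def)

lemma jet_continuous:
  assumes "jet v vt vtt vz vtz"
  shows "continuous_on UNIV (\<lambda>p. v (fst p) (snd p))" "continuous_on UNIV (\<lambda>p. vt (fst p) (snd p))"
    "continuous_on UNIV (\<lambda>p. vtt (fst p) (snd p))" "continuous_on UNIV (\<lambda>p. vz (fst p) (snd p))"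
    "continuous_on UNIV (\<lambda>p. vtz (fst p) (snd p))"
  using assms by (simp_all add: jet_def)

text \<open>A family \<open>t \<mapsto> (t, T t z)\<close> of parabolas whose coefficients are continuously differentiable in the
label \<open>z\<close>. The ordinate \<open>g z\<close> at time \<open>0\<close> is kept general because averaging a family also averages
the label.\<close>

locale smooth_parabolas =
  fixes g b a g' b' a' :: "real \<Rightarrow> real"
  assumes DERIV_g: "(g has_real_derivative g' z) (at z)"
    and DERIV_b: "(b has_real_derivative b' z) (at z)"
    and DERIV_a: "(a has_real_derivative a' z) (at z)"
    and cont_g': "continuous_on UNIV g'"
    and cont_b': "continuous_on UNIV b'"
    and cont_a': "continuous_on UNIV a'"
begin

definition T :: "real \<Rightarrow> real \<Rightarrow> real" where "T t z = g z + b z * t + a z * t\<^sup>2 / 2"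
definition F :: "real \<Rightarrow> real \<Rightarrow> real" where "F t z = b z + a z * t"
definition J :: "real \<Rightarrow> real \<Rightarrow> real" where "J t z = g' z + b' z * t + a' z * t\<^sup>2 / 2"
definition Jt :: "real \<Rightarrow> real \<Rightarrow> real" where "Jt t z = b' z + a' z * t"

lemma cont_family: "continuous_on UNIV g" "continuous_on UNIV b" "continuous_on UNIV a"
  by (intro continuous_at_imp_continuous_on ballI DERIV_isCont[OF DERIV_g] DERIV_isCont[OF DERIV_b]
      DERIV_isCont[OF DERIV_a])+

lemma cont_snd: "continuous_on UNIV h \<Longrightarrow> continuous_on UNIV (\<lambda>p. h (snd p))"
  for h :: "real \<Rightarrow> real"
  by (rule continuous_on_compose2[of UNIV]) (auto intro: continuous_intros)

lemmas cont_coeff [continuous_intros] =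
  cont_family[THEN cont_snd] cont_g'[THEN cont_snd] cont_b'[THEN cont_snd] cont_a'[THEN cont_snd]

lemma cont_TFJ [continuous_intros]:
  "continuous_on UNIV (\<lambda>p. T (fst p) (snd p))" "continuous_on UNIV (\<lambda>p. F (fst p) (snd p))"
  "continuous_on UNIV (\<lambda>p. J (fst p) (snd p))" "continuous_on UNIV (\<lambda>p. Jt (fst p) (snd p))"
  unfolding T_def F_def J_def Jt_def by (intro continuous_intros; simp)+

lemma DERIV_time:
  "((\<lambda>t. T t z) has_real_derivative F t z) (at t)"
  "((\<lambda>t. F t z) has_real_derivative a z) (at t)"
  "((\<lambda>t. J t z) has_real_derivative Jt t z) (at t)"
  "((\<lambda>t. Jt t z) has_real_derivative a' z) (at t)"
  unfolding T_def F_def J_def Jt_def by (auto intro!: derivative_eq_intros)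

lemma DERIV_label:
  "((\<lambda>z. T t z) has_real_derivative J t z) (at z)"
  "((\<lambda>z. F t z) has_real_derivative Jt t z) (at z)"
  unfolding T_def F_def J_def Jt_def by (auto intro!: derivative_eq_intros DERIV_g DERIV_b DERIV_a)

text \<open>In Lagrangian coordinates \<open>\<partial>\<^sub>t\<close> is \<open>\<nabla>\<^sup>f\<close> and \<open>\<partial>\<^sub>t\<^sup>2\<close> is \<open>\<Delta>\<^sup>f\<close>, with \<open>F\<close> for \<open>f\<close> and \<open>a\<close> for
\<open>\<nabla>\<^sup>f f\<close>, while \<open>\<partial>\<^sub>z\<close> is \<open>J \<partial>\<^sub>\<tau>\<close>.\<close>

lemma jet_pullback:
  assumes V: "Ck 2 V"
  shows "jet (\<lambda>t z. V (t, T t z))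
     (\<lambda>t z. d_eta V (t, T t z) + F t z * d_tau V (t, T t z))
     (\<lambda>t z. d_eta (d_eta V) (t, T t z) + 2 * F t z * d_eta (d_tau V) (t, T t z)
        + (F t z)\<^sup>2 * d_tau (d_tau V) (t, T t z) + a z * d_tau V (t, T t z))
     (\<lambda>t z. J t z * d_tau V (t, T t z))
     (\<lambda>t z. J t z * (d_eta (d_tau V) (t, T t z) + F t z * d_tau (d_tau V) (t, T t z))
        + Jt t z * d_tau V (t, T t z))"
proof -
  have D: "V differentiable_on UNIV" "d_eta V differentiable_on UNIV" "d_tau V differentiable_on UNIV"
    using V by (auto simp: numeral_2_eq_2)
  have C: "continuous_on UNIV (\<lambda>p. U (fst p, T (fst p) (snd p)))" if "continuous_on UNIV U" for U :: "real \<times> real \<Rightarrow> real"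
    by (rule continuous_on_compose2[OF that]) (auto intro!: continuous_intros)
  have cont: "continuous_on UNIV V" "continuous_on UNIV (d_eta V)" "continuous_on UNIV (d_tau V)"
    "continuous_on UNIV (d_eta (d_eta V))" "continuous_on UNIV (d_eta (d_tau V))"
    "continuous_on UNIV (d_tau (d_tau V))"
    using V D by (auto simp: numeral_2_eq_2 intro: differentiable_imp_continuous_on)
  have time: "((\<lambda>t. U (t, T t z)) has_real_derivative
      d_eta U (t, T t z) + F t z * d_tau U (t, T t z)) (at t)" if "U differentiable_on UNIV" for U t z
    using DERIV_along_curve[OF that DERIV_ident DERIV_time(1)] by (simp add: mult.commute)
  have label: "((\<lambda>z. U (t, T t z)) has_real_derivative J t z * d_tau U (t, T t z)) (at z)"
    if "U differentiable_on UNIV" for U t z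
    using DERIV_along_curve[OF that DERIV_const DERIV_label(1)] by (simp add: mult.commute)
  note [simp] = mixed_partials_commute[OF V]
  show ?thesis
    unfolding jet_def
  proof (intro conjI allI)
    fix t z
    show "((\<lambda>t. d_eta V (t, T t z) + F t z * d_tau V (t, T t z)) has_real_derivative
        d_eta (d_eta V) (t, T t z) + 2 * F t z * d_eta (d_tau V) (t, T t z)
        + (F t z)\<^sup>2 * d_tau (d_tau V) (t, T t z) + a z * d_tau V (t, T t z)) (at t)"
      by (auto intro!: derivative_eq_intros time D DERIV_time simp: power2_eq_square algebra_simps)
    show "((\<lambda>z. d_eta V (t, T t z) + F t z * d_tau V (t, T t z)) has_real_derivative
        J t z * (d_eta (d_tau V) (t, T t z) + F t z * d_tau (d_tau V) (t, T t z))
        + Jt t z * d_tau V (t, T t z)) (at z)"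
      by (auto intro!: derivative_eq_intros label D DERIV_label simp: algebra_simps)
    show "((\<lambda>t. J t z * d_tau V (t, T t z)) has_real_derivative
        J t z * (d_eta (d_tau V) (t, T t z) + F t z * d_tau (d_tau V) (t, T t z))
        + Jt t z * d_tau V (t, T t z)) (at t)"
      by (auto intro!: derivative_eq_intros time D DERIV_time simp: algebra_simps)
  qed (intro time[OF D(1)] label[OF D(1)] continuous_intros C cont)+
qed

text \<open>If \<open>(u, v)\<close> displaces the points of a parabola, whose velocity is \<open>(1, F)\<close>, then \<open>w = v - F u\<close> is
the displacement transversal to the parabola, and \<open>u\<close> only reparametrises it. This is why \<open>w\<close> alone
survives in the second variation.\<close>

lemma jet_contact:
  assumes u: "jet u ut utt uz utz" and v: "jet v vt vtt vz vtz"
  shows "jet (\<lambda>t z. v t z - F t z * u t z)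
     (\<lambda>t z. vt t z - a z * u t z - F t z * ut t z)
     (\<lambda>t z. vtt t z - 2 * a z * ut t z - F t z * utt t z)
     (\<lambda>t z. vz t z - Jt t z * u t z - F t z * uz t z)
     (\<lambda>t z. vtz t z - a' z * u t z - a z * uz t z - Jt t z * ut t z - F t z * utz t z)"
proof -
  note D' = jetD[OF u] jetD[OF v]
  show ?thesis
    unfolding jet_def
  proof (intro conjI allI)
    fix t z
    show "((\<lambda>t. v t z - F t z * u t z) has_real_derivative vt t z - a z * u t z - F t z * ut t z) (at t)"
      by (auto intro!: derivative_eq_intros D' DERIV_a DERIV_time DERIV_label simp: algebra_simps)
    show "((\<lambda>t. vt t z - a z * u t z - F t z * ut t z) has_real_derivative
        vtt t z - 2 * a z * ut t z - F t z * utt t z) (at t)"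
      by (auto intro!: derivative_eq_intros D' DERIV_a DERIV_time DERIV_label simp: algebra_simps)
    show "((\<lambda>z. v t z - F t z * u t z) has_real_derivative vz t z - Jt t z * u t z - F t z * uz t z) (at z)"
      by (auto intro!: derivative_eq_intros D' DERIV_a DERIV_time DERIV_label simp: algebra_simps)
    show "((\<lambda>z. vt t z - a z * u t z - F t z * ut t z) has_real_derivative
        vtz t z - a' z * u t z - a z * uz t z - Jt t z * ut t z - F t z * utz t z) (at z)"
      by (auto intro!: derivative_eq_intros D' DERIV_a DERIV_time DERIV_label simp: algebra_simps)
    show "((\<lambda>t. vz t z - Jt t z * u t z - F t z * uz t z) has_real_derivative
        vtz t z - a' z * u t z - a z * uz t z - Jt t z * ut t z - F t z * utz t z) (at t)"
      by (auto intro!: derivative_eq_intros D' DERIV_a DERIV_time DERIV_label simp: algebra_simps)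
  qed (intro continuous_intros jet_continuous[OF u] jet_continuous[OF v])+
qed

section \<open>The variations as divergences\<close>

definition c :: "real \<Rightarrow> real" where "c z = sqrt (1 + (a z)\<^sup>2)"
definition s :: "real \<Rightarrow> real" where "s z = a z / c z"

lemma c_pos: "c z > 0"
  by (simp add: c_def add_pos_nonneg)

lemma c_squared: "(c z)\<^sup>2 = 1 + (a z)\<^sup>2"
  by (simp add: c_def add_nonneg_nonneg)

lemma DERIV_c: "(c has_real_derivative s z * a' z) (at z)"
proof -
  have "0 < 1 + (a z)\<^sup>2" by (simp add: add_pos_nonneg)
  then show ?thesis
    unfolding s_def c_def
    by (auto intro!: derivative_eq_intros DERIV_a simp: field_simps)
qed

lemma DERIV_s: "(s has_real_derivative a' z / c z ^ 3) (at z)"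
proof -
  have "(s has_real_derivative (a' z * c z - a z * (s z * a' z)) / (c z * c z)) (at z)"
    unfolding s_def[abs_def]
    by (rule DERIV_cong, rule DERIV_divide[OF DERIV_a DERIV_c]) (use c_pos[of z] in \<open>auto simp: s_def\<close>)
  moreover have "(a' z * c z - a z * (s z * a' z)) / (c z * c z) = a' z * ((c z)\<^sup>2 - (a z)\<^sup>2) / c z ^ 3"
    using c_pos[of z] by (simp add: s_def field_simps power2_eq_square power3_eq_cube)
  ultimately show ?thesis by (simp add: c_squared)
qed

lemma cont_c_s [continuous_intros]: "continuous_on UNIV (\<lambda>p. c (snd p))" "continuous_on UNIV (\<lambda>p. s (snd p))"
  by (intro cont_snd continuous_at_imp_continuous_on ballI DERIV_isCont[OF DERIV_c] DERIV_isCont[OF DERIV_s])+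

text \<open>Here \<open>J\<^sub>t u + J u\<^sub>t + w\<^sub>z\<close> is \<open>J\<close> times the plane divergence of \<open>(V1, V2)\<close>. The integrand equals
\<open>\<partial>\<^sub>t (s J w\<^sub>t - s J\<^sub>t w + c J u) + \<partial>\<^sub>z (c w)\<close>: the two terms \<open>s a' w\<close> that arise from \<open>J\<^sub>t\<^sub>t = a'\<close> and
\<open>c' = s a'\<close> cancel.\<close>

lemma first_variation_divergence:
  assumes u: "jet u ut utt uz utz" and w: "jet w wt wtt wz wtz" and R: "R \<ge> 0" and M: "M \<ge> 0"
    and vanish: "\<And>t z. \<bar>t\<bar> = R \<or> \<bar>t\<bar> \<le> R \<and> \<bar>z\<bar> = M \<Longrightarrow> u t z = 0 \<and> w t z = 0 \<and> wt t z = 0"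
  shows "integral (cbox (- R, - M) (R, M))
    (\<lambda>(t, z). s z * J t z * wtt t z + c z * (Jt t z * u t z + J t z * ut t z + wz t z)) = 0"
proof -
  let ?X = "\<lambda>t z. s z * (J t z * wt t z) - s z * (Jt t z * w t z) + c z * (J t z * u t z)"
  let ?Y = "\<lambda>t z. c z * w t z"
  let ?x = "\<lambda>t z. s z * (J t z * wtt t z) - s z * (a' z * w t z) + c z * (Jt t z * u t z + J t z * ut t z)"
  let ?y = "\<lambda>t z. s z * a' z * w t z + c z * wz t z"
  note cu = jet_continuous[OF u] jet_continuous[OF w]
  have "integral (cbox (- R, - M) (R, M)) (\<lambda>(t, z). ?x t z + ?y t z) = 0"
  proof (rule integral_box_divergence[OF _ _ _ _ R M])
    fix t z
    show "((\<lambda>t. ?X t z) has_real_derivative ?x t z) (at t)"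
      by (auto intro!: derivative_eq_intros jetD[OF u] jetD[OF w] DERIV_time simp: algebra_simps)
    show "(?Y t has_real_derivative ?y t z) (at z)"
      by (auto intro!: derivative_eq_intros jetD[OF w] DERIV_c simp: algebra_simps)
  next
    show "?X (- R) z = 0" "?X R z = 0" for z
      using vanish[of "- R" z] vanish[of R z] R by simp_all
    show "?Y t (- M) = 0" "?Y t M = 0" if "\<bar>t\<bar> \<le> R" for t
      using vanish[of t "- M"] vanish[of t M] that M by simp_all
  qed (intro continuous_intros cu)+
  also have "(\<lambda>(t, z). ?x t z + ?y t z)
      = (\<lambda>(t, z). s z * J t z * wtt t z + c z * (Jt t z * u t z + J t z * ut t z + wz t z))"
    by (auto simp: fun_eq_iff algebra_simps)
  finally show ?thesis .
qed

text \<open>Integration by parts removes every term with a factor \<open>u\<close>. The terms quadratic in \<open>u\<close> leave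
multiples of \<open>a' u\<^sup>2\<close> and the mixed ones multiples of \<open>a' u w\<^sub>t\<close>, which cancel because
\<open>J\<^sub>t\<^sub>t = a'\<close> and \<open>c' = s a'\<close>. From \<open>2 s w\<^sub>t\<^sub>t w\<^sub>z\<close> there remains \<open>s' w\<^sub>t\<^sup>2 = a' w\<^sub>t\<^sup>2 / c\<^sup>3\<close>.\<close>

lemma second_variation_divergence:
  assumes u: "jet u ut utt uz utz" and w: "jet w wt wtt wz wtz" and R: "R \<ge> 0" and M: "M \<ge> 0"
    and vanish: "\<And>t z. \<bar>t\<bar> = R \<or> \<bar>t\<bar> \<le> R \<and> \<bar>z\<bar> = M \<Longrightarrow> u t z = 0 \<and> wt t z = 0"
  shows "integral (cbox (- R, - M) (R, M))
    (\<lambda>(t, z). J t z * (wtt t z)\<^sup>2 / c z ^ 3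
      + s z * J t z * (- 4 * wtt t z * ut t z - 2 * wt t z * utt t z
          - 2 * a z * ((ut t z)\<^sup>2 + u t z * utt t z))
      + 2 * s z * wtt t z * (Jt t z * u t z + J t z * ut t z + wz t z)
      + 2 * c z * (ut t z * wz t z - uz t z * wt t z + Jt t z * u t z * ut t z - a z * u t z * uz t z))
    = integral (cbox (- R, - M) (R, M)) (\<lambda>(t, z). (J t z * (wtt t z)\<^sup>2 + a' z * (wt t z)\<^sup>2) / c z ^ 3)"
    (is "integral ?B ?L = integral ?B ?E")
proof -
  \<comment> \<open>\<open>?X\<close> and \<open>?Y\<close> collect the boundary terms of the integrations by parts in \<open>t\<close> and in \<open>z\<close>.\<close>
  let ?X = "\<lambda>t z. - 2 * (s z * a z) * (J t z * (u t z * ut t z)) + (s z * a z + c z) * (Jt t z * (u t z)\<^sup>2)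
      + 2 * c z * (u t z * wz t z) - 2 * s z * (J t z * (wt t z * ut t z))
      + 2 * s z * (Jt t z * (wt t z * u t z)) + 2 * s z * (wt t z * wz t z)"
  let ?Y = "\<lambda>t z. - (c z * a z * (u t z)\<^sup>2) - 2 * (c z * (u t z * wt t z)) - s z * (wt t z)\<^sup>2"
  let ?x = "\<lambda>t z. - 2 * (s z * a z) * (Jt t z * (u t z * ut t z) + J t z * ((ut t z)\<^sup>2 + u t z * utt t z))
      + (s z * a z + c z) * (a' z * (u t z)\<^sup>2 + 2 * (Jt t z * (u t z * ut t z)))
      + 2 * c z * (ut t z * wz t z + u t z * wtz t z)
      - 2 * s z * (Jt t z * (wt t z * ut t z) + J t z * (wtt t z * ut t z + wt t z * utt t z))
      + 2 * s z * (a' z * (wt t z * u t z) + Jt t z * (wtt t z * u t z + wt t z * ut t z))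
      + 2 * s z * (wtt t z * wz t z + wt t z * wtz t z)"
  let ?y = "\<lambda>t z. - ((s z * a' z * a z + c z * a' z) * (u t z)\<^sup>2 + 2 * (c z * a z * (u t z * uz t z)))
      - 2 * (s z * a' z * (u t z * wt t z) + c z * (uz t z * wt t z + u t z * wtz t z))
      - (a' z / c z ^ 3 * (wt t z)\<^sup>2 + 2 * (s z * (wt t z * wtz t z)))"
  note cu = jet_continuous[OF u] jet_continuous[OF w]
  have c0: "c z \<noteq> 0" for z using c_pos[of z] by simp
  have cxy: "continuous_on UNIV (\<lambda>p. ?x (fst p) (snd p))" "continuous_on UNIV (\<lambda>p. ?y (fst p) (snd p))"
    by (intro continuous_intros cu; simp add: c0)+
  have div: "integral ?B (\<lambda>(t, z). ?x t z + ?y t z) = 0"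
  proof (rule integral_box_divergence[OF _ _ cxy R M])
    fix t z
    show "((\<lambda>t. ?X t z) has_real_derivative ?x t z) (at t)"
      by (auto intro!: derivative_eq_intros jetD[OF u] jetD[OF w] DERIV_time simp: algebra_simps power2_eq_square)
    show "(?Y t has_real_derivative ?y t z) (at z)"
      by (auto intro!: derivative_eq_intros jetD[OF u] jetD[OF w] DERIV_c DERIV_s DERIV_a
          simp: algebra_simps power2_eq_square)
  next
    show "?X (- R) z = 0" "?X R z = 0" for z
      using vanish[of "- R" z] vanish[of R z] R by simp_all
    show "?Y t (- M) = 0" "?Y t M = 0" if "\<bar>t\<bar> \<le> R" for t
      using vanish[of t "- M"] vanish[of t M] that M by simp_all
  qed
  have L: "?L = (\<lambda>p. (case p of (t, z) \<Rightarrow> ?x t z + ?y t z) + ?E p)"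
    by (auto simp: fun_eq_iff add_divide_distrib algebra_simps power2_eq_square)
  have "continuous_on ?B (\<lambda>(t, z). ?x t z + ?y t z)"
    unfolding split_def by (rule continuous_on_subset[OF continuous_on_add[OF cxy]]) simp
  moreover have "continuous_on ?B ?E"
    unfolding split_def
    by (rule continuous_on_subset[of UNIV], intro continuous_intros cu) (simp_all add: c0)
  ultimately show ?thesis
    unfolding L using div by (subst integral_add) (auto intro!: integrable_continuous)
qed

end

text \<open>The values of \<open>f\<close> and \<open>\<psi>\<close> enter as numbers \<open>x\<close> and \<open>y\<close>, so that the same densities serve for \<open>f\<close> and
for the averaged families of parabolas.\<close>

definition lap_at :: "(real \<times> real \<Rightarrow> real) \<Rightarrow> real \<times> real \<Rightarrow> real \<Rightarrow> real \<Rightarrow> real" where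
  "lap_at V p x y = d_eta (d_eta V) p + 2 * x * d_eta (d_tau V) p + x\<^sup>2 * d_tau (d_tau V) p + y * d_tau V p"

definition grad_at :: "(real \<times> real \<Rightarrow> real) \<Rightarrow> real \<times> real \<Rightarrow> real \<Rightarrow> real" where
  "grad_at V p x = d_eta V p + x * d_tau V p"

text \<open>By linearity the two first-order conditions are the cases \<open>V2 = 0\<close> and \<open>V1 = 0\<close> of one condition.\<close>

definition first_density :: "(real \<times> real \<Rightarrow> real) \<Rightarrow> (real \<times> real \<Rightarrow> real) \<Rightarrow> real \<times> real \<Rightarrow> real \<Rightarrow> real \<Rightarrow> real" where
  "first_density V1 V2 p x y =
     y / sqrt (1 + y\<^sup>2) * (lap_at V2 p x y - 2 * y * grad_at V1 p x - x * lap_at V1 p x y)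
     + sqrt (1 + y\<^sup>2) * (d_eta V1 p + d_tau V2 p)"

definition second_density :: "(real \<times> real \<Rightarrow> real) \<Rightarrow> (real \<times> real \<Rightarrow> real) \<Rightarrow> real \<times> real \<Rightarrow> real \<Rightarrow> real \<Rightarrow> real" where
  "second_density V1 V2 p x y =
     (lap_at V2 p x y - 2 * y * grad_at V1 p x - x * lap_at V1 p x y)\<^sup>2 / (1 + y\<^sup>2) powr (3 / 2)
     + y / sqrt (1 + y\<^sup>2) *
         (- 4 * lap_at V2 p x y * grad_at V1 p x - 2 * grad_at V2 p x * lap_at V1 p x y
          + 6 * x * grad_at V1 p x * lap_at V1 p x y + 6 * y * (grad_at V1 p x)\<^sup>2)
     + 2 * (y / sqrt (1 + y\<^sup>2)) *
         (lap_at V2 p x y - 2 * y * grad_at V1 p x - x * lap_at V1 p x y) * (d_eta V1 p + d_tau V2 p)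
     + 2 * sqrt (1 + y\<^sup>2) * (d_eta V1 p * d_tau V2 p - d_tau V1 p * d_eta V2 p)"

definition flat_at :: "(real \<times> real \<Rightarrow> real) \<Rightarrow> real \<times> real \<Rightarrow> bool" where
  "flat_at V p \<longleftrightarrow> V p = 0 \<and> d_eta V p = 0 \<and> d_tau V p = 0 \<and>
     d_eta (d_eta V) p = 0 \<and> d_eta (d_tau V) p = 0 \<and> d_tau (d_tau V) p = 0"

lemma density_flat:
  assumes "flat_at V1 p" "flat_at V2 p"
  shows "first_density V1 V2 p x y = 0" "second_density V1 V2 p x y = 0"
  using assms by (simp_all add: flat_at_def first_density_def second_density_def lap_at_def grad_at_def)

lemma powr_three_halves: "(1 + y\<^sup>2) powr (3 / 2) = sqrt (1 + y\<^sup>2) ^ 3"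
  by (simp add: powr_half_sqrt_powr powr_numeral real_sqrt_power add_nonneg_nonneg)

lemma integral_nonneg_everywhere:
  fixes h :: "real \<times> real \<Rightarrow> real"
  assumes "\<And>p. h p \<ge> 0" shows "integral B h \<ge> 0"
  using assms by (cases "h integrable_on B") (auto intro: integral_nonneg simp: not_integrable_integral)

lemma first_density_algebra:
  fixes a c s J Jt F v e1 d1 d2 L1 L2 :: real
  assumes N: "N1 = e1 + F * d1"
    and w: "wtt = L2 - 2 * a * N1 - F * L1" "wz = J * d2 - Jt * v - F * (J * d1)"
  shows "(s * wtt + c * (e1 + d2)) * J = s * J * wtt + c * (Jt * v + J * N1 + wz)"
  unfolding w N by (simp add: algebra_simps)

text \<open>Here \<open>e1\<close>, \<open>d1\<close> and \<open>e2\<close>, \<open>d2\<close> are the partial derivatives of \<open>V1\<close> and \<open>V2\<close>, \<open>v\<close> is the value of \<open>V1\<close>, and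
\<open>N\<close> and \<open>L\<close> stand for \<open>\<nabla>\<^sup>f\<close> and \<open>\<Delta>\<^sup>f\<close>. The left-hand side is the second density times the Jacobian.\<close>

lemma second_density_algebra:
  fixes a c s q J Jt F v e1 d1 e2 d2 L1 L2 :: real
  assumes N: "N1 = e1 + F * d1" "N2 = e2 + F * d2"
    and w: "wtt = L2 - 2 * a * N1 - F * L1" "wt = N2 - a * v - F * N1" "wz = J * d2 - Jt * v - F * (J * d1)"
  shows "(wtt\<^sup>2 / q + s * (- 4 * L2 * N1 - 2 * N2 * L1 + 6 * F * N1 * L1 + 6 * a * N1\<^sup>2)
        + 2 * s * wtt * (e1 + d2) + 2 * c * (e1 * d2 - d1 * e2)) * J
    = J * wtt\<^sup>2 / q + s * J * (- 4 * wtt * N1 - 2 * wt * L1 - 2 * a * (N1\<^sup>2 + v * L1))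
      + 2 * s * wtt * (Jt * v + J * N1 + wz)
      + 2 * c * (N1 * wz - (J * d1) * wt + Jt * v * N1 - a * v * (J * d1))"
proof -
  have 1: "- 4 * wtt * N1 - 2 * wt * L1 - 2 * a * (N1\<^sup>2 + v * L1)
      = - 4 * L2 * N1 - 2 * N2 * L1 + 6 * F * N1 * L1 + 6 * a * N1\<^sup>2"
    unfolding w by (simp add: algebra_simps power2_eq_square)
  have 2: "Jt * v + J * N1 + wz = J * (e1 + d2)"
    unfolding w N by (simp add: algebra_simps)
  have 3: "N1 * wz - (J * d1) * wt + Jt * v * N1 - a * v * (J * d1) = J * (e1 * d2 - d1 * e2)"
    unfolding w N by (simp add: algebra_simps)
  show ?thesis unfolding 1 2 3 by (simp add: algebra_simps)
qed

context smooth_parabolas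
begin

text \<open>The two integrals of the theorem, after the substitution \<open>\<tau> = T t z\<close>, for a smooth family of parabolas.
The divergences integrate to zero because the bounding parabolas \<open>z = M\<close> and \<open>z = - M\<close> leave the
support of \<open>V1\<close> and \<open>V2\<close>.\<close>

lemma variations_along_parabolas:
  assumes V: "Ck 2 V1" "Ck 2 V2" and R: "R \<ge> 0" and M: "M \<ge> 0"
    and flat: "\<And>p. \<bar>fst p\<bar> \<ge> R \<or> \<bar>snd p\<bar> \<ge> R \<Longrightarrow> flat_at V1 p \<and> flat_at V2 p"
    and T: "\<And>t. \<bar>t\<bar> \<le> R \<Longrightarrow> T t M \<ge> R" "\<And>t. \<bar>t\<bar> \<le> R \<Longrightarrow> T t (- M) \<le> - R"
  shows "integral (cbox (- R, - M) (R, M))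
           (\<lambda>(t, z). first_density V1 V2 (t, T t z) (F t z) (a z) * J t z) = 0"
    and "(\<And>t z. J t z \<ge> 0) \<Longrightarrow> (\<And>z. a' z \<ge> 0) \<Longrightarrow>
         integral (cbox (- R, - M) (R, M))
           (\<lambda>(t, z). second_density V1 V2 (t, T t z) (F t z) (a z) * J t z) \<ge> 0"
proof -
  note u = jet_pullback[OF V(1)]
  note w = jet_contact[OF u jet_pullback[OF V(2)]]
  have vanish: "flat_at V1 (t, T t z) \<and> flat_at V2 (t, T t z)"
    if "\<bar>t\<bar> = R \<or> \<bar>t\<bar> \<le> R \<and> \<bar>z\<bar> = M" for t z
  proof -
    have "R \<le> \<bar>t\<bar> \<or> R \<le> \<bar>T t z\<bar>"
      using that T[of t] by (cases "z \<ge> 0") (auto simp: abs_if split: if_splits)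
    then show ?thesis using flat[of "(t, T t z)"] by simp
  qed
  have cs: "sqrt (1 + (a z)\<^sup>2) = c z" "a z / c z = s z" for z by (simp_all add: c_def s_def)
  note unfold_density = first_density_def second_density_def powr_three_halves cs lap_at_def grad_at_def
  let ?B = "cbox (- R, - M) (R, M)"
  let ?D1 = "\<lambda>t z. first_density V1 V2 (t, T t z) (F t z) (a z) * J t z"
  let ?D2 = "\<lambda>t z. second_density V1 V2 (t, T t z) (F t z) (a z) * J t z"
  show "integral ?B (\<lambda>(t, z). ?D1 t z) = 0"
  proof (rule trans[OF _ first_variation_divergence[OF u w R M]], goal_cases)
    case 1
    show ?case
      by (intro arg_cong[where f = "integral ?B"] ext, clarify, unfold split unfold_density)
         (rule first_density_algebra[OF refl refl refl])
  next
    case (2 t z)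
    then show ?case using vanish[of t z] by (auto simp: flat_at_def)
  qed
  assume J: "\<And>t z. J t z \<ge> 0" and a': "\<And>z. a' z \<ge> 0"
  show "integral ?B (\<lambda>(t, z). ?D2 t z) \<ge> 0"
  proof (rule ord_le_eq_trans[OF _ trans[OF second_variation_divergence[OF u w R M, symmetric]]], goal_cases)
    case 1
    show ?case
      using J a' c_pos
      by (intro integral_nonneg_everywhere) (auto intro!: divide_nonneg_pos add_nonneg_nonneg mult_nonneg_nonneg)
  next
    case (2 t z)
    then show ?case using vanish[of t z] by (auto simp: flat_at_def)
  next
    case 3
    show ?case
      by (intro arg_cong[where f = "integral ?B"] ext, clarify, unfold split unfold_density)
         (rule second_density_algebra[OF refl refl refl refl refl, symmetric])
  qed
qed

end

section \<open>Averaging in the label\<close>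

lemma continuous_on_compose3:
  assumes H: "continuous_on UNIV (\<lambda>q. H (fst q) (fst (snd q)) (snd (snd q)))"
    and "continuous_on S p" "continuous_on S x" "continuous_on S y"
  shows "continuous_on S (\<lambda>r. H (p r) (x r) (y r))"
  using continuous_on_compose2[OF H, of S "\<lambda>r. (p r, x r, y r)"] assms(2-)
  by (simp add: continuous_on_Pair)

text \<open>The Steklov average of \<open>h\<close> over \<open>[z, z + e]\<close>, parametrised so that it makes sense, and is jointly
continuous, down to \<open>e = 0\<close>.\<close>

definition avg :: "(real \<Rightarrow> real) \<Rightarrow> real \<Rightarrow> real \<Rightarrow> real" where
  "avg h e z = integral {0..1} (\<lambda>x. h (z + e * x))"

definition diffq :: "(real \<Rightarrow> real) \<Rightarrow> real \<Rightarrow> real \<Rightarrow> real" where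
  "diffq h e z = (h (z + e) - h z) / e"

lemma avg_0 [simp]: "avg h 0 z = h z"
  by (simp add: avg_def)

lemma continuous_avg:
  assumes "continuous_on UNIV h"
  shows "continuous_on UNIV (\<lambda>q. avg h (fst q) (snd q))"
proof -
  have "continuous_on UNIV (\<lambda>q. integral (cbox 0 1) (\<lambda>x. h (snd q + fst q * x)))"
  proof (rule integral_continuous_on_param)
    show "continuous_on (UNIV \<times> cbox 0 1) (\<lambda>(q, x). h (snd q + fst q * x))"
      unfolding split_def by (rule continuous_on_compose2[OF assms]) (auto intro!: continuous_intros)
  qed
  then show ?thesis by (simp add: avg_def)
qed

lemma avg_mean_bounds:
  assumes h: "continuous_on UNIV h" and lo: "\<And>x. 0 \<le> x \<Longrightarrow> x \<le> 1 \<Longrightarrow> l \<le> h (z + e * x)"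
    and hi: "\<And>x. 0 \<le> x \<Longrightarrow> x \<le> 1 \<Longrightarrow> h (z + e * x) \<le> u"
  shows "l \<le> avg h e z" "avg h e z \<le> u"
proof -
  have i: "(\<lambda>x. h (z + e * x)) integrable_on {0..1}"
    by (intro integrable_continuous_real continuous_on_compose2[OF h]) (auto intro!: continuous_intros)
  have "integral {0..1::real} (\<lambda>x. l) \<le> avg h e z"
    unfolding avg_def by (rule integral_le[OF _ i]) (use lo in auto)
  then show "l \<le> avg h e z" by simp
  have "avg h e z \<le> integral {0..1::real} (\<lambda>x. u)"
    unfolding avg_def by (rule integral_le[OF i]) (use hi in auto)
  then show "avg h e z \<le> u" by simp
qed

lemma DERIV_avg:
  assumes h: "continuous_on UNIV h" and e: "e \<noteq> 0"
  shows "(avg h e has_real_derivative diffq h e z) (at z)"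
proof -
  obtain A where A: "\<And>x. (A has_real_derivative h x) (at x)"
  proof -
    have "\<exists>A. \<forall>x::real. - \<infinity> < ereal x \<longrightarrow> ereal x < \<infinity> \<longrightarrow> (A has_vector_derivative h x) (at x)"
      by (rule einterval_antiderivative)
         (use h in \<open>simp_all add: continuous_on_eq_continuous_at\<close>)
    then obtain A where "\<And>x. (A has_vector_derivative h x) (at x)" by auto
    then show thesis
      by (intro that[of A]) (simp add: has_real_derivative_iff_has_vector_derivative)
  qed
  have "avg h e = (\<lambda>z. (A (z + e) - A z) / e)"
  proof
    fix z
    have "((\<lambda>x. h (z + e * x)) has_integral A (z + e * 1) / e - A (z + e * 0) / e) {0..1}"
    proof (rule fundamental_theorem_of_calculus)
      fix x
      have "((\<lambda>x. z + e * x) has_real_derivative e) (at x)"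
        by (auto intro!: derivative_eq_intros)
      from DERIV_cdivide[OF DERIV_chain2[OF A this], of e]
      have "((\<lambda>x. A (z + e * x) / e) has_real_derivative h (z + e * x)) (at x)"
        using e by simp
      then show "((\<lambda>x. A (z + e * x) / e) has_vector_derivative h (z + e * x)) (at x within {0..1})"
        unfolding has_real_derivative_iff_has_vector_derivative by (rule has_vector_derivative_at_within)
    qed simp
    then show "avg h e z = (A (z + e) - A z) / e"
      unfolding avg_def by (simp add: integral_unique diff_divide_distrib)
  qed
  moreover have "((\<lambda>z. (A (z + e) - A z) / e) has_real_derivative diffq h e z) (at z)"
    unfolding diffq_def
    using A[of "z + e"] by (intro DERIV_cdivide DERIV_diff A) (simp only: DERIV_shift)
  ultimately show ?thesis by simp
qed

lemma continuous_diffq: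
  assumes "continuous_on UNIV h"
  shows "continuous_on UNIV (diffq h e)"
proof -
  have "continuous_on UNIV (\<lambda>z. h (z + e))"
    by (rule continuous_on_compose2[OF assms]) (auto intro: continuous_intros)
  then show ?thesis
    unfolding diffq_def[abs_def] divide_inverse by (intro continuous_intros assms)
qed

context parabolic_foliation
begin

definition slope :: "real \<Rightarrow> real" where "slope z = f (0, z)"
definition curv :: "real \<Rightarrow> real" where "curv z = \<psi> (0, z)"

lemma cont_data: "continuous_on UNIV slope" "continuous_on UNIV curv"
  unfolding slope_def[abs_def] curv_def[abs_def]
  by (intro continuous_on_compose2[OF cont_f] continuous_on_compose2[OF cont_\<psi>] continuous_intros; simp)+

lemma smooth_parabolas_avg:
  assumes "e > 0"
  shows "smooth_parabolas (avg (\<lambda>z. z) e) (avg slope e) (avg curv e)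
           (diffq (\<lambda>z. z) e) (diffq slope e) (diffq curv e)"
  by unfold_locales (use assms in \<open>auto intro!: DERIV_avg continuous_diffq cont_data continuous_on_id\<close>)

definition avg_height :: "real \<Rightarrow> real \<Rightarrow> real \<Rightarrow> real" where
  "avg_height e t z = avg (\<lambda>z. z) e z + avg slope e z * t + avg curv e z * t\<^sup>2 / 2"

definition avg_slope :: "real \<Rightarrow> real \<Rightarrow> real \<Rightarrow> real" where
  "avg_slope e t z = avg slope e z + avg curv e z * t"

definition avg_jacobian :: "real \<Rightarrow> real \<Rightarrow> real \<Rightarrow> real" where
  "avg_jacobian e t z = diffq (\<lambda>z. z) e z + diffq slope e z * t + diffq curv e z * t\<^sup>2 / 2"

lemma avg_jacobian_height: "avg_jacobian e t z = (height f \<psi> t (z + e) - height f \<psi> t z) / e"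
  by (cases "e = 0") (simp_all add: avg_jacobian_def diffq_def slope_def curv_def height_def field_simps)

lemma avg_jacobian_nonneg: "e > 0 \<Longrightarrow> avg_jacobian e t z \<ge> 0"
  using height_mono[of z "z + e" t] by (simp add: avg_jacobian_height)

lemma continuous_height_label: "continuous_on UNIV (height f \<psi> t)"
proof -
  have "height f \<psi> t = (\<lambda>z. z + slope z * t + curv z * t\<^sup>2 / 2)"
    by (simp add: fun_eq_iff height_def slope_def curv_def)
  then show ?thesis by (simp only:) (intro continuous_intros cont_data; simp)
qed

text \<open>Averaging the coefficients is the same as averaging the height, so the monotonicity of the height in
the label carries over.\<close>

lemma avg_height_eq_avg: "avg_height e t z = avg (height f \<psi> t) e z"
proof -
  have i: "(\<lambda>x. h (z + e * x)) integrable_on {0..1}" if "continuous_on UNIV h" for h :: "real \<Rightarrow> real"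
    by (intro integrable_continuous_real continuous_on_compose2[OF that]) (auto intro!: continuous_intros)
  note i' = i[OF continuous_on_id] i[OF cont_data(1)] i[OF cont_data(2)]
  have "((\<lambda>x. (z + e * x) + slope (z + e * x) * t + curv (z + e * x) * (t\<^sup>2 / 2)) has_integral
      avg (\<lambda>z. z) e z + avg slope e z * t + avg curv e z * (t\<^sup>2 / 2)) {0..1}"
    unfolding avg_def
    by (intro has_integral_add has_integral_mult_left integrable_integral i')
  then show ?thesis
    by (simp add: avg_height_def avg_def[of "height f \<psi> t"] height_def slope_def curv_def integral_unique)
qed

lemma avg_height_between:
  assumes "0 \<le> e" shows "height f \<psi> t z \<le> avg_height e t z" "avg_height e t z \<le> height f \<psi> t (z + e)"
  unfolding avg_height_eq_avg
  by (rule avg_mean_bounds[OF continuous_height_label, where u = "height f \<psi> t (z + e)" and l = "height f \<psi> t z"];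
      use assms in \<open>auto intro!: height_mono simp: mult_left_le\<close>)+

lemma continuous_avg3 [continuous_intros]:
  assumes "continuous_on UNIV h"
  shows "continuous_on UNIV (\<lambda>q. avg h (fst q) (snd (snd q)))"
proof -
  have "continuous_on UNIV (\<lambda>q. (fst q, snd (snd q)))" by (intro continuous_intros)
  from continuous_on_compose2[OF continuous_avg[OF assms] this] show ?thesis by simp
qed

lemma continuous_avg_family:
  "continuous_on UNIV (\<lambda>q. avg_height (fst q) (fst (snd q)) (snd (snd q)))"
  "continuous_on UNIV (\<lambda>q. avg_slope (fst q) (fst (snd q)) (snd (snd q)))"
  unfolding avg_height_def avg_slope_def by (intro continuous_intros cont_data; simp)+

lemma continuous_avg_family_fixed:
  "continuous_on UNIV (\<lambda>q. avg_height e (fst q) (snd q))" "continuous_on UNIV (\<lambda>q. avg_slope e (fst q) (snd q))"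
  "continuous_on UNIV (\<lambda>q. avg curv e (snd q))" "continuous_on UNIV (\<lambda>q. avg_jacobian e (fst q) (snd q))"
proof -
  have p: "continuous_on UNIV (\<lambda>q. (e, q))" by (intro continuous_intros)
  show "continuous_on UNIV (\<lambda>q. avg_height e (fst q) (snd q))" "continuous_on UNIV (\<lambda>q. avg_slope e (fst q) (snd q))"
    "continuous_on UNIV (\<lambda>q. avg curv e (snd q))"
    using continuous_on_compose2[OF continuous_avg_family(1) p] continuous_on_compose2[OF continuous_avg_family(2) p]
      continuous_on_compose2[OF continuous_avg3[OF cont_data(2)] p] by simp_all
  have c: "continuous_on UNIV (\<lambda>q :: real \<times> real. diffq h e (snd q))" if "continuous_on UNIV h" for h
    by (rule continuous_on_compose2[OF continuous_diffq[OF that]]) (auto intro: continuous_intros)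
  show "continuous_on UNIV (\<lambda>q. avg_jacobian e (fst q) (snd q))"
    unfolding avg_jacobian_def by (intro continuous_intros c cont_data; simp)
qed

lemma DERIV_avg_height:
  assumes "e > 0" shows "(avg_height e t has_real_derivative avg_jacobian e t z) (at z)"
proof -
  interpret S: smooth_parabolas "avg (\<lambda>z. z) e" "avg slope e" "avg curv e"
      "diffq (\<lambda>z. z) e" "diffq slope e" "diffq curv e"
    by (rule smooth_parabolas_avg[OF assms])
  show ?thesis
    using S.DERIV_label(1)[of t z] by (simp add: S.T_def S.J_def avg_height_def[abs_def] avg_jacobian_def)
qed

lemma integral_change_of_label:
  assumes e: "e > 0" and G: "continuous_on UNIV G" and "R \<ge> 0" "M \<ge> 0"
    and supp: "\<And>y. \<bar>y\<bar> \<ge> R \<Longrightarrow> G y = 0"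
    and T: "avg_height e t M \<ge> R" "avg_height e t (- M) \<le> - R"
  shows "integral {- M..M} (\<lambda>z. G (avg_height e t z) * avg_jacobian e t z) = integral {- R..R} G"
proof -
  note D = DERIV_avg_height[OF e]
  have "compact (avg_height e t ` {- M..M})"
    by (intro compact_continuous_image continuous_at_imp_continuous_on ballI DERIV_isCont[OF D] compact_Icc)
  then obtain B where B: "\<And>x. x \<in> avg_height e t ` {- M..M} \<Longrightarrow> \<bar>x\<bar> \<le> B"
    using compact_imp_bounded bounded_real by metis
  have "((\<lambda>z. avg_jacobian e t z *\<^sub>R G (avg_height e t z)) has_integral integral {avg_height e t (- M)..avg_height e t M} G) {- M..M}"
  proof (rule has_integral_substitution[where c = "- B" and d = B])
    show "avg_height e t ` {- M..M} \<subseteq> {- B..B}" using B by (fastforce simp: abs_le_iff)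
    show "continuous_on {- B..B} G" by (rule continuous_on_subset[OF G]) simp
  qed (use T assms(3,4) D in \<open>auto intro: has_field_derivative_at_within\<close>)
  then have "integral {- M..M} (\<lambda>z. G (avg_height e t z) * avg_jacobian e t z) = integral {avg_height e t (- M)..avg_height e t M} G"
    by (simp add: integral_unique mult.commute)
  also have "\<dots> = integral {- R..R} G"
    by (rule integral_spike_set)
       (use T supp in \<open>auto simp: abs_le_iff intro!: negligible_subset[of "{}"]\<close>)
  finally show ?thesis .
qed

text \<open>For an integrand defined on the plane the averaged parabolas may be used as coordinates without any
error.\<close>

lemma integral_eulerian_lagrangian:
  assumes e: "0 < e" "e \<le> 1" and G: "continuous_on UNIV G" and R: "R \<ge> 0" and M: "M \<ge> 0"
    and supp: "\<And>p. \<bar>fst p\<bar> \<ge> R \<or> \<bar>snd p\<bar> \<ge> R \<Longrightarrow> G p = 0"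
    and far: "\<And>t. \<bar>t\<bar> \<le> R \<Longrightarrow> height f \<psi> t M \<ge> R" "\<And>t. \<bar>t\<bar> \<le> R \<Longrightarrow> height f \<psi> t (1 - M) \<le> - R"
  shows "(LINT p|lborel. G p) = integral (cbox (- R, - M) (R, M)) (\<lambda>(t, z). G (t, avg_height e t z) * avg_jacobian e t z)"
proof -
  let ?B = "cbox (- R, - R) (R, R)"
  have GB: "continuous_on ?B G" by (rule continuous_on_subset[OF G]) simp
  have "(\<lambda>p. indicator ?B p *\<^sub>R G p) = G"
    using supp by (force simp: fun_eq_iff indicator_def abs_le_iff not_le)
  then have "(LINT p|lborel. G p) = set_lebesgue_integral lborel ?B G"
    by (simp add: set_lebesgue_integral_def)
  also have "\<dots> = integral ?B G"
    by (rule set_borel_integral_eq_integral(2))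
       (unfold set_integrable_def, rule borel_integrable_compact[OF compact_cbox GB])
  also have "\<dots> = integral {- R..R} (\<lambda>t. integral {- R..R} (\<lambda>y. G (t, y)))"
    using integral_prod_continuous[OF GB] by simp
  also have "\<dots> = integral {- R..R} (\<lambda>t. integral {- M..M} (\<lambda>z. G (t, avg_height e t z) * avg_jacobian e t z))"
  proof (rule integral_cong)
    fix t assume "t \<in> {- R..R}"
    then have t: "\<bar>t\<bar> \<le> R" by auto
    show "integral {- R..R} (\<lambda>y. G (t, y)) = integral {- M..M} (\<lambda>z. G (t, avg_height e t z) * avg_jacobian e t z)"
    proof (rule integral_change_of_label[OF e(1) _ R M, symmetric])
      show "continuous_on UNIV (\<lambda>y. G (t, y))"
        by (rule continuous_on_compose2[OF G]) (auto intro!: continuous_intros)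
      show "G (t, y) = 0" if "R \<le> \<bar>y\<bar>" for y using supp[of "(t, y)"] that by simp
      show "avg_height e t M \<ge> R"
        using far(1)[OF t] avg_height_between(1)[of e t M] e by linarith
      show "avg_height e t (- M) \<le> - R"
        using far(2)[OF t] avg_height_between(2)[of e t "- M"] height_mono[of "- M + e" "1 - M" t] e by linarith
    qed
  qed
  also have "\<dots> = integral (cbox (- R, - M) (R, M)) (\<lambda>(t, z). G (t, avg_height e t z) * avg_jacobian e t z)"
  proof -
    have "continuous_on UNIV (\<lambda>p. G (fst p, avg_height e (fst p) (snd p)) * avg_jacobian e (fst p) (snd p))"
      by (intro continuous_intros continuous_on_compose2[OF G] continuous_avg_family_fixed) auto
    then have "continuous_on (cbox (- R, - M) (R, M)) (\<lambda>(t, z). G (t, avg_height e t z) * avg_jacobian e t z)"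
      unfolding split_def by (rule continuous_on_subset) simp
    from integral_prod_continuous[OF this] show ?thesis by simp
  qed
  finally show ?thesis .
qed

text \<open>By \<open>integral_eulerian_lagrangian\<close> the integral on the right can be written along the averaged parabolas, with \<open>f\<close>
and \<open>\<psi>\<close> evaluated at the points of these parabolas. What separates the two sides is the defect \<open>E\<close>
between those values and the slope and acceleration of the averaged parabola. It is jointly
continuous and vanishes for \<open>e = 0\<close>, so it is uniformly small, while the integral of the Jacobian is
bounded by the area between two fixed parabolas.\<close>

proposition lagrangian_limit:
  assumes H: "continuous_on UNIV (\<lambda>q. H (fst q) (fst (snd q)) (snd (snd q)))" and R: "R \<ge> 0" and M: "M \<ge> 0"
    and supp: "\<And>p x y. \<bar>fst p\<bar> \<ge> R \<or> \<bar>snd p\<bar> \<ge> R \<Longrightarrow> H p x y = 0"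
    and far: "\<And>t. \<bar>t\<bar> \<le> R \<Longrightarrow> height f \<psi> t M \<ge> R" "\<And>t. \<bar>t\<bar> \<le> R \<Longrightarrow> height f \<psi> t (1 - M) \<le> - R"
  shows "((\<lambda>e. integral (cbox (- R, - M) (R, M))
            (\<lambda>(t, z). H (t, avg_height e t z) (avg_slope e t z) (avg curv e z) * avg_jacobian e t z))
          \<longlongrightarrow> (LINT p|lborel. H p (f p) (\<psi> p))) (at_right 0)"
proof -
  let ?B = "cbox (- R, - M) (R, M)"
  define G where "G p = H p (f p) (\<psi> p)" for p
  have cG: "continuous_on UNIV G"
    unfolding G_def[abs_def] by (intro continuous_on_compose3[OF H] cont_f cont_\<psi> continuous_on_id)
  define E where "E e t z = H (t, avg_height e t z) (avg_slope e t z) (avg curv e z) - G (t, avg_height e t z)" for e t z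
  have cE: "continuous_on UNIV (\<lambda>q. E (fst q) (fst (snd q)) (snd (snd q)))"
    unfolding E_def
    by (intro continuous_on_diff continuous_on_compose3[OF H] continuous_on_compose2[OF cG]
        continuous_intros continuous_avg_family cont_data) auto
  have E0: "E 0 t z = 0" for t z
  proof -
    have "avg_height 0 t z = height f \<psi> t z" "avg_slope 0 t z = f (0, z) + \<psi> (0, z) * t" "avg curv 0 z = \<psi> (0, z)"
      by (simp_all add: avg_height_def avg_slope_def height_def slope_def curv_def)
    then show ?thesis by (simp add: E_def G_def along_height)
  qed
  define C where "C = integral {- R..R} (\<lambda>t. height f \<psi> t (M + 1) - height f \<psi> t (- M))"
  have J: "integral ?B (\<lambda>(t, z). avg_jacobian e t z) \<le> C" if e: "0 < e" "e \<le> 1" for e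
  proof -
    have in1: "integral {- M..M} (avg_jacobian e t) = avg_height e t M - avg_height e t (- M)" for t
    proof (rule integral_unique, rule fundamental_theorem_of_calculus)
      show "(avg_height e t has_vector_derivative avg_jacobian e t z) (at z within {- M..M})" for z
        using DERIV_avg_height[OF e(1), of t z]
        unfolding has_real_derivative_iff_has_vector_derivative by (rule has_vector_derivative_at_within)
    qed (use M in simp)
    have "continuous_on ?B (\<lambda>(t, z). avg_jacobian e t z)"
      unfolding split_def by (rule continuous_on_subset[OF continuous_avg_family_fixed(4)]) simp
    from integral_prod_continuous[OF this]
    have "integral ?B (\<lambda>(t, z). avg_jacobian e t z) = integral {- R..R} (\<lambda>t. avg_height e t M - avg_height e t (- M))"
      by (simp add: in1)
    also have "\<dots> \<le> C"
      unfolding C_def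
    proof (rule integral_le)
      have c: "continuous_on UNIV (\<lambda>t. avg_height e t z)" for z
        unfolding avg_height_def by (intro continuous_intros) auto
      show "(\<lambda>t. avg_height e t M - avg_height e t (- M)) integrable_on {- R..R}"
        by (intro integrable_continuous_real continuous_on_subset[OF continuous_on_diff[OF c c]]) simp
      show "(\<lambda>t. height f \<psi> t (M + 1) - height f \<psi> t (- M)) integrable_on {- R..R}"
        by (intro integrable_continuous_real
            continuous_on_subset[OF continuous_on_diff[OF continuous_height continuous_height]]) simp
      show "avg_height e t M - avg_height e t (- M) \<le> height f \<psi> t (M + 1) - height f \<psi> t (- M)" for t
        using avg_height_between(2)[of e t M] avg_height_between(1)[of e t "- M"] height_mono[of "M + e" "M + 1" t] e
        by linarith
    qed
    finally show ?thesis .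
  qed
  have C0: "C \<ge> 0"
  proof -
    have "height f \<psi> t (- M) \<le> height f \<psi> t (M + 1)" for t
      by (rule height_mono) (use M in simp)
    then show ?thesis
      unfolding C_def
      by (intro integral_nonneg integrable_continuous_real
          continuous_on_subset[OF continuous_on_diff[OF continuous_height continuous_height]]) auto
  qed
  have "\<forall>\<^sub>F e in at_right 0. dist (integral ?B
          (\<lambda>(t, z). H (t, avg_height e t z) (avg_slope e t z) (avg curv e z) * avg_jacobian e t z)) (LINT p|lborel. G p) < k"
    if k: "k > 0" for k
  proof -
    define l where "l = k / (C + 1)"
    have l: "l > 0" "l * C < k" using k C0 by (auto simp: l_def field_simps)
    let ?K = "{0..1} \<times> {- R..R} \<times> {- M..M}"
    have "uniformly_continuous_on ?K (\<lambda>q. E (fst q) (fst (snd q)) (snd (snd q)))"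
      by (intro compact_uniformly_continuous continuous_on_subset[OF cE] compact_Times compact_Icc) simp
    then obtain d where d: "d > 0" and unif: "\<And>p q. p \<in> ?K \<Longrightarrow> q \<in> ?K \<Longrightarrow> dist q p < d \<Longrightarrow>
        dist (E (fst q) (fst (snd q)) (snd (snd q))) (E (fst p) (fst (snd p)) (snd (snd p))) < l"
      unfolding uniformly_continuous_on_def using l(1) by metis
    have close: "dist (integral ?B
          (\<lambda>(t, z). H (t, avg_height e t z) (avg_slope e t z) (avg curv e z) * avg_jacobian e t z)) (LINT p|lborel. G p) < k"
      if e: "0 < e" "e < min d 1" for e
    proof -
      have El: "\<bar>E e t z\<bar> \<le> l" if "(t, z) \<in> ?B" for t z
        using unif[of "(0, t, z)" "(e, t, z)"] that e by (simp add: E0 dist_prod_def)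
      have c1: "continuous_on ?B (\<lambda>(t, z). H (t, avg_height e t z) (avg_slope e t z) (avg curv e z) * avg_jacobian e t z)"
        unfolding split_def
        by (rule continuous_on_subset[of UNIV], intro continuous_on_mult continuous_on_compose3[OF H]
            continuous_on_Pair continuous_on_fst continuous_on_id continuous_avg_family_fixed) simp
      have c2: "continuous_on ?B (\<lambda>(t, z). G (t, avg_height e t z) * avg_jacobian e t z)"
        unfolding split_def
        by (rule continuous_on_subset[of UNIV], intro continuous_on_mult continuous_on_compose2[OF cG]
            continuous_on_Pair continuous_on_fst continuous_on_id continuous_avg_family_fixed) simp_all
      have c3: "continuous_on ?B (\<lambda>(t, z). avg_jacobian e t z)"
        unfolding split_def by (rule continuous_on_subset[OF continuous_avg_family_fixed(4)]) simp
      have "integral ?B (\<lambda>(t, z). H (t, avg_height e t z) (avg_slope e t z) (avg curv e z) * avg_jacobian e t z) - (LINT p|lborel. G p)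
          = integral ?B (\<lambda>p. (case p of (t, z) \<Rightarrow> H (t, avg_height e t z) (avg_slope e t z) (avg curv e z) * avg_jacobian e t z)
              - (case p of (t, z) \<Rightarrow> G (t, avg_height e t z) * avg_jacobian e t z))"
        using integral_eulerian_lagrangian[of e G R M] e cG R M supp far
          integral_diff[OF integrable_continuous[OF c1] integrable_continuous[OF c2]]
        by (simp add: G_def)
      also have "\<dots> = integral ?B (\<lambda>(t, z). E e t z * avg_jacobian e t z)"
        by (rule arg_cong[where f = "integral _"]) (auto simp: fun_eq_iff E_def algebra_simps)
      also have "norm \<dots> \<le> integral ?B (\<lambda>p. l * (case p of (t, z) \<Rightarrow> avg_jacobian e t z))"
      proof (rule integral_norm_bound_integral)
        have "(\<lambda>(t, z). E e t z * avg_jacobian e t z) = (\<lambda>p. (case p of (t, z) \<Rightarrow> H (t, avg_height e t z) (avg_slope e t z) (avg curv e z) * avg_jacobian e t z)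
              - (case p of (t, z) \<Rightarrow> G (t, avg_height e t z) * avg_jacobian e t z))"
          by (auto simp: fun_eq_iff E_def algebra_simps)
        then show "(\<lambda>(t, z). E e t z * avg_jacobian e t z) integrable_on ?B"
          using integrable_diff[OF integrable_continuous[OF c1] integrable_continuous[OF c2]] by simp
        show "(\<lambda>p. l * (case p of (t, z) \<Rightarrow> avg_jacobian e t z)) integrable_on ?B"
          by (intro integrable_continuous continuous_on_mult continuous_on_const c3)
        show "norm (case p of (t, z) \<Rightarrow> E e t z * avg_jacobian e t z) \<le> l * (case p of (t, z) \<Rightarrow> avg_jacobian e t z)"
          if "p \<in> ?B" for p
        proof (cases p)
          case (Pair t z)
          then show ?thesis
            using mult_right_mono[OF El avg_jacobian_nonneg[OF e(1)], of t z t z] that avg_jacobian_nonneg[OF e(1), of t z]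
            by (simp add: abs_mult)
        qed
      qed
      also have "\<dots> = l * integral ?B (\<lambda>(t, z). avg_jacobian e t z)" by simp
      also have "\<dots> \<le> l * C" using J[of e] e l(1) by (intro mult_left_mono) auto
      also have "\<dots> < k" by (rule l(2))
      finally show ?thesis by (simp add: dist_norm)
    qed
    show ?thesis
      unfolding eventually_at_right_field using close d by (intro exI[of _ "min d 1"]) auto
  qed
  then show ?thesis unfolding G_def by (intro tendstoI)
qed

end

section \<open>Stationarity and stability\<close>

lemma d_outside_support:
  assumes p: "p \<notin> closure {p. V p \<noteq> 0}"
  shows "d_eta V p = 0" "d_tau V p = 0"
proof -
  define S where "S = - closure {p. V p \<noteq> 0}"
  have S: "open S" "p \<in> S" using p by (auto simp: S_def)
  have V0: "V q = 0" if "q \<in> S" for q using that closure_subset[of "{p. V p \<noteq> 0}"] by (auto simp: S_def)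
  have "open ((\<lambda>x. (x, snd p)) -` S)" "open ((\<lambda>y. (fst p, y)) -` S)"
    by (intro open_vimage S continuous_intros)+
  then have ev: "\<forall>\<^sub>F x in nhds (fst p). V (x, snd p) = 0" "\<forall>\<^sub>F y in nhds (snd p). V (fst p, y) = 0"
    unfolding eventually_nhds using S V0 by (metis prod.collapse vimageE vimageI2)+
  show "d_eta V p = 0"
    unfolding d_eta_def using deriv_cong_ev[OF ev(1) refl] by simp
  show "d_tau V p = 0"
    unfolding d_tau_def using deriv_cong_ev[OF ev(2) refl] by simp
qed

lemma support_derivative_subset:
  "closure {p. d_eta V p \<noteq> 0} \<subseteq> closure {p. V p \<noteq> 0}"
  "closure {p. d_tau V p \<noteq> 0} \<subseteq> closure {p. V p \<noteq> 0}"
  by (rule closure_minimal; use d_outside_support[of _ V] in auto)+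

lemma Cc_smooth_flat_outside:
  assumes "V \<in> Cc_smooth"
  obtains R where "R > 0" "\<And>p. R \<le> \<bar>fst p\<bar> \<or> R \<le> \<bar>snd p\<bar> \<Longrightarrow> flat_at V p"
proof -
  have "bounded (closure {p. V p \<noteq> 0})"
    using assms by (auto simp: Cc_smooth_def compact_imp_bounded)
  then obtain B where B: "B > 0" "\<And>p. p \<in> closure {p. V p \<noteq> 0} \<Longrightarrow> norm p \<le> B"
    by (auto simp: bounded_pos)
  show thesis
  proof (rule that[of "B + 1"])
    fix p :: "real \<times> real" assume p: "B + 1 \<le> \<bar>fst p\<bar> \<or> B + 1 \<le> \<bar>snd p\<bar>"
    have "norm p > B"
      using p norm_fst_le[of "fst p" "snd p"] norm_snd_le[of "snd p" "fst p"] by auto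
    then have out: "p \<notin> closure {p. V p \<noteq> 0}" using B(2)[of p] by auto
    then have "V p = 0" using closure_subset[of "{p. V p \<noteq> 0}"] by auto
    moreover have "p \<notin> closure {p. d_eta V p \<noteq> 0}" "p \<notin> closure {p. d_tau V p \<noteq> 0}"
      using out support_derivative_subset[of V] by auto
    ultimately show "flat_at V p"
      using d_outside_support[OF out] d_outside_support[of p "d_eta V"] d_outside_support[of p "d_tau V"]
      by (simp add: flat_at_def)
  qed (use B in simp)
qed

lemma zero_Cc_smooth: "(\<lambda>_. 0) \<in> Cc_smooth"
proof -
  have [simp]: "d_eta (\<lambda>_. 0) = (\<lambda>_. 0)" "d_tau (\<lambda>_. 0) = (\<lambda>_. 0)"
    by (auto simp: d_eta_def d_tau_def fun_eq_iff)
  have "Ck k (\<lambda>_. 0)" for k by (induction k) auto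
  then show ?thesis by (simp add: Cc_smooth_def)
qed

lemma continuous_densities:
  assumes V: "Ck 2 V1" "Ck 2 V2"
  shows "continuous_on UNIV (\<lambda>q. first_density V1 V2 (fst q) (fst (snd q)) (snd (snd q)))"
    and "continuous_on UNIV (\<lambda>q. second_density V1 V2 (fst q) (fst (snd q)) (snd (snd q)))"
proof -
  have c: "continuous_on UNIV (\<lambda>q :: (real \<times> real) \<times> real \<times> real. U (fst q))"
    if "U \<in> {d_eta V1, d_tau V1, d_eta (d_eta V1), d_eta (d_tau V1), d_tau (d_tau V1),
             d_eta V2, d_tau V2, d_eta (d_eta V2), d_eta (d_tau V2), d_tau (d_tau V2)}"
    for U
  proof -
    have "continuous_on UNIV U"
      using that V by (auto simp: numeral_2_eq_2 intro: differentiable_imp_continuous_on)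
    then show ?thesis by (rule continuous_on_compose2) (auto intro: continuous_intros)
  qed
  have pos: "sqrt (1 + (y::real)\<^sup>2) \<noteq> 0" for y by (simp add: add_nonneg_eq_0_iff)
  note cl = continuous_on_add continuous_on_diff continuous_on_mult continuous_on_divide continuous_on_power
    continuous_on_real_sqrt continuous_on_const continuous_on_fst continuous_on_snd continuous_on_id
  show "continuous_on UNIV (\<lambda>q. first_density V1 V2 (fst q) (fst (snd q)) (snd (snd q)))"
    unfolding first_density_def lap_at_def grad_at_def
    by (intro cl c; simp add: pos del: real_sqrt_eq_0_iff)
  show "continuous_on UNIV (\<lambda>q. second_density V1 V2 (fst q) (fst (snd q)) (snd (snd q)))"
    unfolding second_density_def lap_at_def grad_at_def powr_three_halves
    by (intro cl c; simp add: pos del: real_sqrt_eq_0_iff)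
qed

context parabolic_foliation
begin

text \<open>An average of a nondecreasing function has nonnegative derivative, so the smooth case applies to the
averaged parabolas, and its two conclusions pass to the limit \<open>e \<rightarrow> 0\<close>.\<close>

proposition stationary_and_stable:
  assumes V1: "V1 \<in> Cc_smooth" and V2: "V2 \<in> Cc_smooth"
  shows "(LINT p|lborel. first_density V1 V2 p (f p) (\<psi> p)) = 0"
    and "(LINT p|lborel. second_density V1 V2 p (f p) (\<psi> p)) \<ge> 0"
proof -
  have Ck: "Ck 2 V1" "Ck 2 V2" using V1 V2 by (auto simp: Cc_smooth_def)
  obtain R1 R2 where R12: "R1 > 0" "\<And>p. R1 \<le> \<bar>fst p\<bar> \<or> R1 \<le> \<bar>snd p\<bar> \<Longrightarrow> flat_at V1 p"
    "R2 > 0" "\<And>p. R2 \<le> \<bar>fst p\<bar> \<or> R2 \<le> \<bar>snd p\<bar> \<Longrightarrow> flat_at V2 p"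
    using Cc_smooth_flat_outside[OF V1] Cc_smooth_flat_outside[OF V2] by metis
  define R where "R = max R1 R2"
  have R: "R \<ge> 0" and flat: "\<And>p. R \<le> \<bar>fst p\<bar> \<or> R \<le> \<bar>snd p\<bar> \<Longrightarrow> flat_at V1 p \<and> flat_at V2 p"
    using R12 by (auto simp: R_def)
  obtain M where M: "M > 1" and far: "\<And>t. \<bar>t\<bar> \<le> R \<Longrightarrow> height f \<psi> t M \<ge> R"
    "\<And>t. \<bar>t\<bar> \<le> R \<Longrightarrow> height f \<psi> t (1 - M) \<le> - R"
    using height_beyond[of R] by metis
  have M0: "M \<ge> 0" using M by simp
  let ?I = "\<lambda>H e. integral (cbox (- R, - M) (R, M))
              (\<lambda>(t, z). H (t, avg_height e t z) (avg_slope e t z) (avg curv e z) * avg_jacobian e t z)"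
  have smooth: "?I (first_density V1 V2) e = 0 \<and> ?I (second_density V1 V2) e \<ge> 0"
    if e: "0 < e" "e < 1" for e
  proof -
    interpret S: smooth_parabolas "avg (\<lambda>z. z) e" "avg slope e" "avg curv e"
        "diffq (\<lambda>z. z) e" "diffq slope e" "diffq curv e"
      by (rule smooth_parabolas_avg[OF e(1)])
    have eq: "S.T = avg_height e" "S.F = avg_slope e" "S.J = avg_jacobian e"
      by (simp_all add: fun_eq_iff S.T_def S.F_def S.J_def avg_height_def avg_slope_def avg_jacobian_def)
    have T: "avg_height e t M \<ge> R" "avg_height e t (- M) \<le> - R" if t: "\<bar>t\<bar> \<le> R" for t
      using far[OF t] avg_height_between(1)[of e t M] avg_height_between(2)[of e t "- M"]
        height_mono[of "- M + e" "1 - M" t] e by linarith+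
    have a': "diffq curv e z \<ge> 0" for z
      using monoD[OF mono_acceleration, of z "z + e"] e by (simp add: diffq_def curv_def)
    show ?thesis
      using S.variations_along_parabolas(1)[OF Ck R M0, unfolded eq, OF flat T]
        S.variations_along_parabolas(2)[OF Ck R M0, unfolded eq, OF flat T avg_jacobian_nonneg[OF e(1)] a']
      by blast
  qed
  have ev: "\<forall>\<^sub>F e in at_right 0. 0 < e \<and> e < (1::real)"
    unfolding eventually_at_right_field by (intro exI[of _ 1]) auto
  have lim: "(?I (first_density V1 V2) \<longlongrightarrow> (LINT p|lborel. first_density V1 V2 p (f p) (\<psi> p))) (at_right 0)"
    "(?I (second_density V1 V2) \<longlongrightarrow> (LINT p|lborel. second_density V1 V2 p (f p) (\<psi> p))) (at_right 0)"
    by (rule lagrangian_limit[OF continuous_densities(1)[OF Ck] R M0 _ far];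
        use flat density_flat in blast)
       (rule lagrangian_limit[OF continuous_densities(2)[OF Ck] R M0 _ far];
        use flat density_flat in blast)
  have "(?I (first_density V1 V2) \<longlongrightarrow> 0) (at_right 0)"
    by (rule tendsto_eventually) (use ev in \<open>eventually_elim, simp add: smooth\<close>)
  with lim(1) show "(LINT p|lborel. first_density V1 V2 p (f p) (\<psi> p)) = 0"
    by (intro tendsto_unique[OF trivial_limit_at_right_real])
  show "(LINT p|lborel. second_density V1 V2 p (f p) (\<psi> p)) \<ge> 0"
    by (rule tendsto_lowerbound[OF lim(2) _ trivial_limit_at_right_real])
       (use ev in \<open>eventually_elim, simp add: smooth\<close>)
qed

end

theorem theorem8p2:
  fixes f \<psi> :: "real \<times> real \<Rightarrow> real"
  assumes "f \<in> C1W"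
    and "weak_Lagrangian_solution f"
    and "\<psi> = intrinsic_grad f"
  shows "\<forall>V1\<in>Cc_smooth. \<forall>V2\<in>Cc_smooth.
    0 = (LINT p|lborel.
           \<psi> p / sqrt (1 + (\<psi> p)\<^sup>2) * (- 2 * \<psi> p * nabla f V1 p - f p * Lap f V1 p)
           + sqrt (1 + (\<psi> p)\<^sup>2) * d_eta V1 p) \<and>
    0 = (LINT p|lborel.
           \<psi> p / sqrt (1 + (\<psi> p)\<^sup>2) * Lap f V2 p + sqrt (1 + (\<psi> p)\<^sup>2) * d_tau V2 p) \<and>
    0 \<le> II f V1 V2"
proof (intro ballI conjI)
  fix V1 V2 assume V: "V1 \<in> Cc_smooth" "V2 \<in> Cc_smooth"
  interpret parabolic_foliation f \<psi>
    using weak_Lagrangian_parabolic_foliation[OF assms(1,2)] assms(3) by simp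
  have jets: "nabla f V p = grad_at V p (f p)" "Lap f V p = lap_at V p (f p) (\<psi> p)" for V p
    by (simp_all add: nabla_def grad_at_def Lap_def lap_at_def assms(3))
  have [simp]: "d_eta (\<lambda>_. 0) p = 0" "d_tau (\<lambda>_. 0) p = 0" for p
    by (simp_all add: d_eta_def d_tau_def)
  have [simp]: "d_eta (\<lambda>_. 0) = (\<lambda>_. 0)" "d_tau (\<lambda>_. 0) = (\<lambda>_. 0)"
    by (simp_all add: fun_eq_iff)
  have [simp]: "grad_at (\<lambda>_. 0) p x = 0" "lap_at (\<lambda>_. 0) p x y = 0" for p x y
    by (simp_all add: grad_at_def lap_at_def)
  \<comment> \<open>Setting one of the two fields to zero separates the two first-order conditions.\<close>
  show "0 = (LINT p|lborel.
           \<psi> p / sqrt (1 + (\<psi> p)\<^sup>2) * (- 2 * \<psi> p * nabla f V1 p - f p * Lap f V1 p)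
           + sqrt (1 + (\<psi> p)\<^sup>2) * d_eta V1 p)"
    using stationary_and_stable(1)[OF V(1) zero_Cc_smooth] by (simp add: first_density_def jets)
  show "0 = (LINT p|lborel. \<psi> p / sqrt (1 + (\<psi> p)\<^sup>2) * Lap f V2 p + sqrt (1 + (\<psi> p)\<^sup>2) * d_tau V2 p)"
    using stationary_and_stable(1)[OF zero_Cc_smooth V(2)] by (simp add: first_density_def jets)
  show "0 \<le> II f V1 V2"
    using stationary_and_stable(2)[OF V] unfolding II_def Let_def assms(3)[symmetric] jets second_density_def .
qed

end
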